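(* Let $M$ be a $C^\infty$ manifold of dimension $n$, let $k\ge 2$, and let $\omega$ be a $k$-tensor on $M$ whose local expression in a coordinate chart $(x,U)$ is $$\omega=\sum_I a_I\,dx^{i_1}\otimes dx^{i_2}\otimes\cdots\otimes dx^{i_k},$$ where $I=(i_1,\ldots,i_k)$ ranges over all multi-indices with $1\le i_1\le n,\ldots,1\le i_k\le n$ and the $a_I:U\to\mathbf{R}$ are $C^\infty$. Then on $U$ the Leibniz coboundary of $\omega$ is $$d(\omega)=L(\omega)+\sum_I a_I\Big\{S(dx^{i_1}\otimes dx^{i_2}\otimes\cdots\otimes dx^{i_k})-dx^{i_1}\otimes S(dx^{i_2}\otimes dx^{i_3}\otimes\cdots\otimes dx^{i_k})+dx^{i_1}\otimes dx^{i_2}\otimes S(dx^{i_3}\otimes\cdots\otimes dx^{i_k})+\cdots+(-1)^{k-2}dx^{i_1}\otimes\cdots\otimes dx^{i_{k-2}}\otimes S(dx^{i_{k-1}}\otimes dx^{i_k})\Big\},$$ where $L$ and $S$ are the local operators defined in the context.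
   Context: $\chi(M)$ denotes the Lie algebra of $C^\infty$ vector fields on $M$ (similarly $\chi(U)$). A $k$-tensor on $M$ is a $C^\infty$ section of $T^*(M)^{\otimes k}$ (no symmetry assumed); it determines an $\mathbf{R}$-linear map $\chi(M)^{\otimes k}\to C^\infty(M)$ by $\omega(X_1\otimes\cdots\otimes X_k)(p)=\omega(X_1(p)\otimes\cdots\otimes X_k(p))$. The Leibniz coboundary of an $\mathbf{R}$-linear map $\alpha:\chi(M)^{\otimes k}\to C^\infty(M)$ is $$d\alpha(X_1\otimes\cdots\otimes X_{k+1})=\sum_{i=1}^{k+1}(-1)^{i+1}X_i\big(\alpha(X_1\otimes\cdots\hat X_i\cdots\otimes X_{k+1})\big)+\sum_{1\le i<j\le k+1}(-1)^{j+1}\alpha\big(X_1\otimes\cdots\otimes X_{i-1}\otimes[X_i,X_j]\otimes X_{i+1}\otimes\cdots\hat X_j\cdots\otimes X_{k+1}\big).$$ For a $k$-tensor $\omega$, the value of $d\omega(X_1\otimes\cdots\otimes X_{k+1})$ at a point depends only on the $X_i$ near that point, so $d\omega$ can be evaluated at $p\in U$ on vector fields $X_i\in\chi(U)$ by replacing them with global vector fields that agree with $X_i$ on a neighborhood of $p$. The operator $\frac{\partial}{\partial x^\ell}\circ dx^p:\chi(U)\to C^\infty(U)$ is given by $\big(\frac{\partial}{\partial x^\ell}\circ dx^p\big)\big(\sum_{i=1}^n b_i\frac{\partial}{\partial x^i}\big)=\frac{\partial b_p}{\partial x^\ell}$. A tensor product $A_1\otimes\cdots\otimes A_m$ of $\mathbf{R}$-linear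 operators $A_i:\chi(U)\to C^\infty(U)$ acts on $X_1\otimes\cdots\otimes X_m$ as the product of functions $A_1(X_1)\cdots A_m(X_m)$. Definition of $L$: $$L(\omega)=\sum_I\sum_{\ell=1}^n\frac{\partial a_I}{\partial x^\ell}\Big\{dx^\ell\otimes dx^{i_1}\otimes\cdots\otimes dx^{i_k}-dx^{i_1}\otimes dx^\ell\otimes dx^{i_2}\otimes\cdots\otimes dx^{i_k}+dx^{i_1}\otimes dx^{i_2}\otimes dx^\ell\otimes\cdots\otimes dx^{i_k}+\cdots+(-1)^{k+2}dx^{i_1}\otimes\cdots\otimes dx^{i_k}\otimes dx^\ell\Big\},$$ i.e. the term with $dx^\ell$ in position $j$ ($1\le j\le k+1$) has sign $(-1)^{j+1}$. Definition of $S$ (for any number $k\ge2$ of factors; it is applied to tensor products of any number $\geq 2$ of factors by the same formula): $$S(dx^{i_1}\otimes\cdots\otimes dx^{i_k})=\sum_{m=3}^{k+1}\sum_{\ell=1}^n dx^\ell\otimes dx^{i_1}\otimes\cdots\otimes dx^{i_{m-2}}\otimes\Big(\frac{\partial}{\partial x^\ell}\circ dx^{i_{m-1}}\Big)\otimes dx^{i_m}\otimes\cdots\otimes dx^{i_k}$$ $$\qquad+\sum_{m=3}^{k+1}(-1)^{m+1}\sum_{\ell=1}^n dx^\ell\otimes dx^{i_2}\otimes\cdots\otimes dx^{i_{m-1}}\otimes\Big(\frac{\partial}{\partial x^\ell}\circ dx^{i_1}\Big)\otimes dx^{i_m}\otimes\cdots\otimes dx^{i_k},$$ where in each term the composite operator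 $\frac{\partial}{\partial x^\ell}\circ dx^{\bullet}$ occupies the $m$-th of the $k+1$ tensor positions (so for $m=k+1$ it is the last factor). *)

theory Defs
  imports "HOL-Analysis.Analysis"
begin

section \<open>Smooth functions of \<open>n\<close> real variables\<close>

text \<open>
  The model space is the library's \<^term>\<open>Euclidean_space n\<close>: points are functions
  \<^typ>\<open>nat \<Rightarrow> real\<close> vanishing from index \<open>n\<close> on.  Coordinates, and hence all multi-indices below,
  are numbered \<open>0, \<dots>, n - 1\<close> instead of \<open>1, \<dots>, n\<close>.
\<close>

definition partial_deriv :: "nat \<Rightarrow> ((nat \<Rightarrow> real) \<Rightarrow> real) \<Rightarrow> (nat \<Rightarrow> real) \<Rightarrow> real" where
  "partial_deriv i f z = deriv (\<lambda>t. f (z(i := t))) (z i)"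

definition iterated_partial :: "nat list \<Rightarrow> ((nat \<Rightarrow> real) \<Rightarrow> real) \<Rightarrow> (nat \<Rightarrow> real) \<Rightarrow> real" where
  "iterated_partial is f = foldr partial_deriv is f"

text \<open>To be used for sets \<open>S\<close> that are open in \<^term>\<open>Euclidean_space n\<close>; only the values of \<open>f\<close> on
  \<open>S\<close> matter.\<close>

definition smooth_on_Euclidean :: "nat \<Rightarrow> (nat \<Rightarrow> real) set \<Rightarrow> ((nat \<Rightarrow> real) \<Rightarrow> real) \<Rightarrow> bool" where
  "smooth_on_Euclidean n S f \<longleftrightarrow>
     (\<forall>is. set is \<subseteq> {..<n} \<longrightarrow>
        continuous_map (subtopology (Euclidean_space n) S) euclideanreal (iterated_partial is f) \<and>
        (\<forall>i<n. \<forall>z\<in>S. (\<lambda>t. iterated_partial is f (z(i := t))) field_differentiable at (z i)))"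

section \<open>Smooth manifolds\<close>

text \<open>A chart is a pair \<open>(U, x)\<close>; the map \<open>x\<close> is a total function of which only the values on
  \<open>U\<close> are meaningful.  The underlying space of the manifold is the whole type \<open>'m\<close>.\<close>

type_synonym 'm chart = "'m set \<times> ('m \<Rightarrow> nat \<Rightarrow> real)"

definition is_chart :: "nat \<Rightarrow> ('m::topological_space) chart \<Rightarrow> bool" where
  "is_chart n = (\<lambda>(U, x). open U \<and> openin (Euclidean_space n) (x ` U) \<and>
     homeomorphic_map (top_of_set U) (subtopology (Euclidean_space n) (x ` U)) x)"

definition smooth_transition :: "nat \<Rightarrow> 'm chart \<Rightarrow> 'm chart \<Rightarrow> bool" where
  "smooth_transition n = (\<lambda>(U, x) (V, y).
     \<forall>i<n. smooth_on_Euclidean n (x ` (U \<inter> V)) (\<lambda>z. y (inv_into U x z) i))"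

text \<open>\<open>A\<close> is a maximal smooth atlas on the second countable Hausdorff space \<open>'m\<close>.\<close>

definition smooth_manifold ::
    "nat \<Rightarrow> ('m::{t2_space,second_countable_topology}) chart set \<Rightarrow> bool" where
  "smooth_manifold n A \<longleftrightarrow>
     (\<forall>c\<in>A. is_chart n c) \<and>
     (\<Union>c\<in>A. fst c) = UNIV \<and>
     (\<forall>c\<in>A. \<forall>d\<in>A. smooth_transition n c d) \<and>
     (\<forall>c. is_chart n c \<and> (\<forall>d\<in>A. smooth_transition n c d \<and> smooth_transition n d c) \<longrightarrow> c \<in> A)"

text \<open>\<open>C\<^sup>\<infinity>(V)\<close> for open \<open>V\<close>; again the functions are total and only their values on \<open>V\<close> matter.\<close>

definition smooth_functions :: "nat \<Rightarrow> 'm chart set \<Rightarrow> 'm set \<Rightarrow> ('m \<Rightarrow> real) set" where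
  "smooth_functions n A V =
     {f. \<forall>(U, x)\<in>A. smooth_on_Euclidean n (x ` (U \<inter> V)) (\<lambda>z. f (inv_into U x z))}"

definition smooth_near :: "nat \<Rightarrow> ('m::topological_space) chart set \<Rightarrow> 'm \<Rightarrow> ('m \<Rightarrow> real) \<Rightarrow> bool" where
  "smooth_near n A p f \<longleftrightarrow> (\<exists>V. open V \<and> p \<in> V \<and> f \<in> smooth_functions n A V)"

section \<open>Tangent vectors and vector fields\<close>

text \<open>
  Tangent vectors at \<open>p\<close> are the derivations at \<open>p\<close> of the functions that are smooth near \<open>p\<close>.
  Such a derivation only depends on the germ of its argument, because a function
  vanishing near \<open>p\<close> is a product with a function that vanishes near \<open>p\<close> as well.  The value \<open>0\<close>
  at functions that are not smooth near \<open>p\<close> makes equality of tangent vectors equality of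
  functionals; \<open>on_germs\<close> enforces this convention.
\<close>

type_synonym 'm functional = "('m \<Rightarrow> real) \<Rightarrow> real"
type_synonym 'm vector_field = "'m \<Rightarrow> 'm functional"

definition on_germs ::
    "nat \<Rightarrow> ('m::topological_space) chart set \<Rightarrow> 'm \<Rightarrow> 'm functional \<Rightarrow> 'm functional" where
  "on_germs n A p v = (\<lambda>f. if smooth_near n A p f then v f else 0)"

definition tangent_space :: "nat \<Rightarrow> ('m::topological_space) chart set \<Rightarrow> 'm \<Rightarrow> 'm functional set" where
  "tangent_space n A p =
     {v. (\<forall>f g c d. smooth_near n A p f \<and> smooth_near n A p g \<longrightarrow>
            v (\<lambda>q. c * f q + d * g q) = c * v f + d * v g \<and>
            v (\<lambda>q. f q * g q) = f p * v g + g p * v f) \<and>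
         (\<forall>f. \<not> smooth_near n A p f \<longrightarrow> v f = 0)}"

text \<open>\<open>\<chi>(U)\<close> for open \<open>U\<close>; \<open>\<chi>(M)\<close> is the case \<open>U = UNIV\<close>.  Values outside \<open>U\<close> are irrelevant.\<close>

definition vector_fields :: "nat \<Rightarrow> ('m::topological_space) chart set \<Rightarrow> 'm set \<Rightarrow> 'm vector_field set" where
  "vector_fields n A U =
     {X. (\<forall>p\<in>U. X p \<in> tangent_space n A p) \<and>
         (\<forall>V f. open V \<and> V \<subseteq> U \<and> f \<in> smooth_functions n A V \<longrightarrow>
            (\<lambda>p. X p f) \<in> smooth_functions n A V)}"

definition lie_bracket ::
    "nat \<Rightarrow> ('m::topological_space) chart set \<Rightarrow> 'm vector_field \<Rightarrow> 'm vector_field \<Rightarrow> 'm vector_field" where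
  "lie_bracket n A X Y = (\<lambda>p. on_germs n A p (\<lambda>f. X p (\<lambda>q. Y q f) - Y p (\<lambda>q. X q f)))"

text \<open>The operator \<open>\<partial>/\<partial>x\<^sup>i\<close> on functions, and the tangent vector \<open>\<partial>/\<partial>x\<^sup>i\<close> at \<open>p\<close>.\<close>

definition coord_deriv :: "'m chart \<Rightarrow> nat \<Rightarrow> ('m \<Rightarrow> real) \<Rightarrow> 'm \<Rightarrow> real" where
  "coord_deriv = (\<lambda>(U, x) i f p. partial_deriv i (\<lambda>z. f (inv_into U x z)) (x p))"

definition coord_vector ::
    "nat \<Rightarrow> ('m::topological_space) chart set \<Rightarrow> 'm chart \<Rightarrow> nat \<Rightarrow> 'm vector_field" where
  "coord_vector n A c i = (\<lambda>p. on_germs n A p (\<lambda>f. coord_deriv c i f p))"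

definition coord_covector :: "'m chart \<Rightarrow> nat \<Rightarrow> 'm functional \<Rightarrow> real" where
  "coord_covector = (\<lambda>(U, x) i v. v (\<lambda>q. x q i))"

section \<open>Tensors\<close>

definition multi_indices :: "nat \<Rightarrow> nat \<Rightarrow> nat list set" where
  "multi_indices n k = {I. length I = k \<and> set I \<subseteq> {..<n}}"

text \<open>
  An element of \<open>(T\<^sub>p\<^sup>*)\<^sup>\<otimes>\<^sup>k\<close> is a \<open>k\<close>-linear form on \<open>T\<^sub>p\<close>, given as a function on lists of length \<open>k\<close>.
  Smoothness of a section is smoothness of its coefficients in every chart.
\<close>

definition multilinear_form :: "nat \<Rightarrow> 'm functional set \<Rightarrow> ('m functional list \<Rightarrow> real) \<Rightarrow> bool" where
  "multilinear_form k T w \<longleftrightarrow>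
     (\<forall>vs i u v c d. length vs = k \<and> set vs \<subseteq> T \<and> i < k \<and> u \<in> T \<and> v \<in> T \<longrightarrow>
        w (vs[i := (\<lambda>f. c * u f + d * v f)]) = c * w (vs[i := u]) + d * w (vs[i := v]))"

definition is_tensor ::
    "nat \<Rightarrow> ('m::topological_space) chart set \<Rightarrow> nat \<Rightarrow> ('m \<Rightarrow> 'm functional list \<Rightarrow> real) \<Rightarrow> bool" where
  "is_tensor n A k \<omega> \<longleftrightarrow>
     (\<forall>p. multilinear_form k (tangent_space n A p) (\<omega> p)) \<and>
     (\<forall>c\<in>A. \<forall>I\<in>multi_indices n k.
        (\<lambda>p. \<omega> p (map (\<lambda>i. coord_vector n A c i p) I)) \<in> smooth_functions n A (fst c))"

section \<open>Operators on tensor powers of vector fields and the Leibniz coboundary\<close>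

text \<open>A linear map from \<open>\<chi>(U)\<^sup>\<otimes>\<^sup>k\<close> to functions is represented by its values on decomposable tensors
  \<open>X\<^sub>1 \<otimes> \<cdots> \<otimes> X\<^sub>k\<close>, entered as the list \<open>[X\<^sub>1, \<dots>, X\<^sub>k]\<close>.\<close>

type_synonym 'm operator = "'m vector_field list \<Rightarrow> 'm \<Rightarrow> real"

definition tensor_operator :: "('m \<Rightarrow> 'm functional list \<Rightarrow> real) \<Rightarrow> 'm operator" where
  "tensor_operator \<omega> Xs p = \<omega> p (map (\<lambda>X. X p) Xs)"

definition delete_nth :: "nat \<Rightarrow> 'a list \<Rightarrow> 'a list" where
  "delete_nth i xs = take i xs @ drop (Suc i) xs"

text \<open>List positions start at \<open>0\<close>, so the signs \<open>(-1)\<^sup>i\<^sup>+\<^sup>1\<close> and \<open>(-1)\<^sup>j\<^sup>+\<^sup>1\<close> for positions counted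
  from \<open>1\<close> become \<open>(-1)\<^sup>i\<close> and \<open>(-1)\<^sup>j\<close>.\<close>

definition leibniz_coboundary ::
    "nat \<Rightarrow> ('m::topological_space) chart set \<Rightarrow> 'm operator \<Rightarrow> 'm operator" where
  "leibniz_coboundary n A \<alpha> Xs p =
     (\<Sum>i<length Xs. (-1) ^ i * (Xs ! i) p (\<alpha> (delete_nth i Xs))) +
     (\<Sum>j<length Xs. \<Sum>i<j.
        (-1) ^ j * \<alpha> (delete_nth j (Xs[i := lie_bracket n A (Xs ! i) (Xs ! j)])) p)"

text \<open>The value at \<open>p\<close> of a local operator \<open>\<alpha>\<close> on \<open>\<chi>(M)\<^sup>\<otimes>\<^sup>k\<close> at fields that are only defined near \<open>p\<close>:
  the common value at all global fields that agree with the given ones near \<open>p\<close>.\<close>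

definition local_value ::
    "nat \<Rightarrow> ('m::topological_space) chart set \<Rightarrow> 'm operator \<Rightarrow> 'm operator" where
  "local_value n A \<alpha> Xs p =
     (THE v. \<exists>Ys. length Ys = length Xs \<and> set Ys \<subseteq> vector_fields n A UNIV \<and>
        (\<forall>i<length Xs. \<forall>\<^sub>F q in nhds p. (Ys ! i) q = (Xs ! i) q) \<and> v = \<alpha> Ys p)"

section \<open>The local operators\<close>

type_synonym 'm field_operator = "'m vector_field \<Rightarrow> 'm \<Rightarrow> real"

definition dx :: "'m chart \<Rightarrow> nat \<Rightarrow> 'm field_operator" where
  "dx c i X p = coord_covector c i (X p)"

text \<open>\<open>d_dx c l i\<close> is the operator \<open>\<partial>/\<partial>x\<^sup>l \<circ> dx\<^sup>i\<close>.\<close>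

definition d_dx :: "'m chart \<Rightarrow> nat \<Rightarrow> nat \<Rightarrow> 'm field_operator" where
  "d_dx c l i X = coord_deriv c l (dx c i X)"

text \<open>\<open>A\<^sub>1 \<otimes> \<cdots> \<otimes> A\<^sub>m\<close> for operators on single fields, and \<open>A\<^sub>1 \<otimes> \<cdots> \<otimes> A\<^sub>m \<otimes> T\<close> for an operator \<open>T\<close> on
  the remaining fields.\<close>

definition op_product :: "'m field_operator list \<Rightarrow> 'm operator" where
  "op_product As Xs p = (\<Prod>r<length As. (As ! r) (Xs ! r) p)"

definition op_tensor :: "'m field_operator list \<Rightarrow> 'm operator \<Rightarrow> 'm operator" where
  "op_tensor As T Xs p = op_product As (take (length As) Xs) p * T (drop (length As) Xs) p"

text \<open>In \<open>L\<close>, \<open>j\<close> is the position, counted from \<open>1\<close>, of the factor \<open>dx\<^sup>l\<close>.\<close>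

definition L_op :: "nat \<Rightarrow> 'm chart \<Rightarrow> nat \<Rightarrow> (nat list \<Rightarrow> 'm \<Rightarrow> real) \<Rightarrow> 'm operator" where
  "L_op n c k a Xs p =
     (\<Sum>I\<in>multi_indices n k. \<Sum>l<n. coord_deriv c l (a I) p *
        (\<Sum>j=1..k+1. (-1) ^ (j + 1) *
           op_product (map (dx c) (take (j - 1) I @ [l] @ drop (j - 1) I)) Xs p))"

text \<open>
  \<open>S_op n c I\<close> is \<open>S\<close> applied to the tensor product of the \<open>dx\<^sup>i\<close> with \<open>i\<close> running through the list
  \<open>I = [i\<^sub>1, \<dots>, i\<^sub>k]\<close>, and \<open>m\<close> is the position, counted from \<open>1\<close>, of the composite operator.
  Thus \<open>take (m - 2) I\<close> is \<open>[i\<^sub>1, \<dots>, i\<^sub>m\<^sub>-\<^sub>2]\<close>, \<open>I ! (m - 2)\<close> is \<open>i\<^sub>m\<^sub>-\<^sub>1\<close>, \<open>drop (m - 1) I\<close> is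
  \<open>[i\<^sub>m, \<dots>, i\<^sub>k]\<close>, and \<open>take (m - 2) (tl I)\<close> is \<open>[i\<^sub>2, \<dots>, i\<^sub>m\<^sub>-\<^sub>1]\<close>.
\<close>

definition S_op :: "nat \<Rightarrow> 'm chart \<Rightarrow> nat list \<Rightarrow> 'm operator" where
  "S_op n c I Xs p =
     (\<Sum>m=3..length I + 1. \<Sum>l<n.
        op_product ([dx c l] @ map (dx c) (take (m - 2) I) @ [d_dx c l (I ! (m - 2))] @
          map (dx c) (drop (m - 1) I)) Xs p) +
     (\<Sum>m=3..length I + 1. (-1) ^ (m + 1) * (\<Sum>l<n.
        op_product ([dx c l] @ map (dx c) (take (m - 2) (tl I)) @ [d_dx c l (hd I)] @
          map (dx c) (drop (m - 1) I)) Xs p))"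

end

theory Submission
  imports Defs "HOL-Computational_Algebra.Polynomial"
begin

text \<open>
  The right-hand side of the claimed formula is what is left of the Leibniz coboundary after all
  possible cancellations, and the proof has an algebraic and an analytic half.

  Algebra.  Fix a multi-index \<open>I\<close> and expand the coboundary of the summand of \<open>\<omega>\<close> with coefficient
  \<open>a\<^sub>I\<close> on fields \<open>X\<^sub>j\<close> by the Leibniz rule and by \<open>[X, Y]\<^sup>i = X(Y\<^sup>i) - Y(X\<^sup>i)\<close>.
  The derivatives \<open>X\<^sub>j(a\<^sub>I)\<close> make up \<open>L\<close>.  All other terms
  contain one derivative of a component of one field along another field.  If the differentiated
  field precedes the differentiating one, the term from the first sum of the coboundary is
  cancelled by half of a bracket.  If it comes immediately after the differentiating field, the
  term from the first sum and the one from the other half of the bracket cancel each other.  In the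
  remaining terms the differentiated field follows the field \<open>r\<close> that differentiates it at distance
  at least 2; grouped by \<open>r\<close>, they are the two sums defining \<open>S\<close>, applied to the last factors, with
  the sign and the first factors shown in the formula.  This is \<open>leibniz_cancellation\<close>, and
  \<open>op_tensor_S_op\<close> identifies the surviving terms.

  Analysis.  A tangent vector is an abstract derivation on germs, and fields on a chart must be
  replaced by global ones.  Two facts are therefore needed.  First, a derivation is
  \<open>\<Sum>l. v(x\<^sup>l) \<partial>/\<partial>x\<^sup>l\<close> in a chart (\<open>tangent_coordinate_expansion\<close>); this rests on Hadamard's lemma, whose
  remainder terms must be smooth in every chart of the atlas, hence on the smoothness of composites
  and of parameter integrals.  Second, a field on a chart domain agrees near a given point with a
  global field (\<open>vector_field_extension\<close>), by multiplication with a bump function; so the local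
  value of the coboundary is taken at existing fields, and it is unique because the formula
  depends only on germs.  Smoothness is proved coinductively
  (\<open>smooth_on_Euclidean_coinduct\<close> and \<open>smooth_on_Euclidean_coinduct_algebra\<close>): a set of continuous functions whose partial derivatives are
  polynomials in members of the set consists of smooth functions.
\<close>

section \<open>Smooth functions on open subsets of the model space\<close>

text \<open>
  Open cubes rather than balls serve as basic neighbourhoods: changing one coordinate, or
  contracting towards the centre, visibly stays inside, and all estimates are coordinatewise.
\<close>
definition cube :: "nat \<Rightarrow> (nat \<Rightarrow> real) \<Rightarrow> real \<Rightarrow> (nat \<Rightarrow> real) set" where
  "cube n c d = {w \<in> topspace (Euclidean_space n). \<forall>i<n. \<bar>w i - c i\<bar> < d}"

lemma Euclidean_space_eq_top_of_set:
  "Euclidean_space n = top_of_set (topspace (Euclidean_space n))"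
  by (simp add: Euclidean_space_def euclidean_product_topology)

lemma subtopology_Euclidean_space:
  assumes "S \<subseteq> topspace (Euclidean_space n)"
  shows "subtopology (Euclidean_space n) S = top_of_set S"
  using assms Euclidean_space_eq_top_of_set[of n]
  by (metis inf.absorb_iff2 subtopology_subtopology)

lemma fun_upd_in_topspace_Euclidean_space:
  "z \<in> topspace (Euclidean_space n) \<Longrightarrow> i < n \<Longrightarrow> z(i := t) \<in> topspace (Euclidean_space n)"
  by (auto simp: topspace_Euclidean_space)

lemma openin_cube: "openin (Euclidean_space n) (cube n c d)"
proof -
  have eq: "{w::nat \<Rightarrow> real. \<forall>i<n. \<bar>w i - c i\<bar> < d} = (\<Inter>i\<in>{..<n}. {w. \<bar>w i - c i\<bar> < d})"
    by auto
  have "open {w::nat \<Rightarrow> real. \<bar>w i - c i\<bar> < d}" for i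
    by (intro open_Collect_less continuous_intros) auto
  then have "open {w::nat \<Rightarrow> real. \<forall>i<n. \<bar>w i - c i\<bar> < d}"
    unfolding eq by (intro open_INT) auto
  then have "openin (top_of_set (topspace (Euclidean_space n)))
      (topspace (Euclidean_space n) \<inter> {w. \<forall>i<n. \<bar>w i - c i\<bar> < d})"
    by (rule openin_open_Int)
  moreover have "topspace (Euclidean_space n) \<inter> {w. \<forall>i<n. \<bar>w i - c i\<bar> < d} = cube n c d"
    by (auto simp: cube_def)
  ultimately show ?thesis
    using Euclidean_space_eq_top_of_set[of n] by simp
qed

lemma centre_in_cube: "c \<in> topspace (Euclidean_space n) \<Longrightarrow> 0 < d \<Longrightarrow> c \<in> cube n c d"
  by (auto simp: cube_def)

lemma cube_subset_openin:
  assumes S: "openin (Euclidean_space n) S" and z: "z \<in> S"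
  obtains d where "0 < d" "cube n z d \<subseteq> S"
proof -
  obtain T where T: "open T" "S = topspace (Euclidean_space n) \<inter> T"
    using S Euclidean_space_eq_top_of_set[of n] by (metis openin_open)
  have "openin (product_topology (\<lambda>i. euclidean) (UNIV::nat set)) T"
    using T(1) by (simp add: euclidean_product_topology)
  then obtain X where X: "z \<in> (\<Pi>\<^sub>E i\<in>UNIV. X i)" "\<And>i. openin euclideanreal (X i)"
      "(\<Pi>\<^sub>E i\<in>UNIV. X i) \<subseteq> T" "finite {i. X i \<noteq> topspace euclideanreal}"
    using product_topology_open_contains_basis[of "\<lambda>i. euclideanreal" UNIV T z] T(2) z
    by auto
  have "\<exists>e>0. \<forall>t. \<bar>t - z i\<bar> < e \<longrightarrow> t \<in> X i" for i
    using X(1) X(2)[of i] by (auto simp: PiE_iff open_real open_dist dist_real_def)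
  then obtain e where e: "\<And>i. 0 < e i" "\<And>i t. \<bar>t - z i\<bar> < e i \<Longrightarrow> t \<in> X i"
    by metis
  define d where "d = Min (insert 1 (e ` {..<n} \<union> e ` {i. X i \<noteq> topspace euclideanreal}))"
  have "0 < d"
    unfolding d_def using e(1) X(4) by (subst Min_gr_iff) auto
  moreover have "cube n z d \<subseteq> S"
  proof
    fix w assume w: "w \<in> cube n z d"
    have "w i \<in> X i" for i
    proof (cases "i < n")
      case True
      then have "d \<le> e i"
        unfolding d_def using X(4) by (intro Min_le) auto
      moreover have "\<bar>w i - z i\<bar> < d"
        using w True by (auto simp: cube_def)
      ultimately show ?thesis
        by (intro e(2)) auto
    next
      case False
      then have "w i = z i"
        using w T(2) z by (auto simp: cube_def topspace_Euclidean_space)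
      then show ?thesis
        using X(1) by (auto simp: PiE_iff)
    qed
    then have "w \<in> T"
      using X(3) by (auto simp: PiE_iff)
    then show "w \<in> S"
      using w T(2) by (auto simp: cube_def)
  qed
  ultimately show thesis
    using that by blast
qed

lemma openin_Euclidean_subset: "openin (Euclidean_space n) S \<Longrightarrow> S \<subseteq> topspace (Euclidean_space n)"
  by (rule openin_subset)

text \<open>
  Hence a partial derivative at a point of an open set depends only on the values of the function
  on that set.
\<close>
lemma eventually_fun_upd_in:
  assumes "openin (Euclidean_space n) S" "z \<in> S" "i < n"
  shows "\<forall>\<^sub>F t in nhds (z i). z(i := t) \<in> S"
proof -
  obtain d where d: "0 < d" "cube n z d \<subseteq> S"
    using cube_subset_openin assms by blast
  have "\<forall>\<^sub>F t in nhds (z i). dist t (z i) < d"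
    using d(1) by (auto simp: eventually_nhds_metric)
  then show ?thesis
  proof eventually_elim
    case (elim t)
    have "z(i := t) \<in> cube n z d"
      using elim d(1) assms openin_Euclidean_subset[OF assms(1)]
        fun_upd_in_topspace_Euclidean_space[of z n i t]
      by (auto simp: cube_def dist_real_def)
    then show ?case using d(2) by blast
  qed
qed

abbreviation has_partial ::
    "((nat \<Rightarrow> real) \<Rightarrow> real) \<Rightarrow> nat \<Rightarrow> (nat \<Rightarrow> real) \<Rightarrow> real \<Rightarrow> bool" where
  "has_partial f i z D \<equiv> ((\<lambda>t. f (z(i := t))) has_real_derivative D) (at (z i))"

lemma has_partial_imp_partial_deriv: "has_partial f i z D \<Longrightarrow> partial_deriv i f z = D"
  by (simp add: partial_deriv_def DERIV_imp_deriv)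

lemma field_differentiable_imp_has_partial:
  "(\<lambda>t. f (z(i := t))) field_differentiable at (z i) \<Longrightarrow> has_partial f i z (partial_deriv i f z)"
  by (simp add: partial_deriv_def field_differentiable_derivI)

lemma has_partial_cong:
  assumes "openin (Euclidean_space n) S" "z \<in> S" "i < n" "\<And>w. w \<in> S \<Longrightarrow> f w = g w"
  shows "has_partial f i z D \<longleftrightarrow> has_partial g i z D"
proof -
  have "\<forall>\<^sub>F t in nhds (z i). f (z(i := t)) = g (z(i := t))"
    using eventually_fun_upd_in[OF assms(1-3)] by eventually_elim (rule assms(4))
  then show ?thesis
    by (intro DERIV_cong_ev) auto
qed

lemma partial_deriv_cong:
  assumes "openin (Euclidean_space n) S" "z \<in> S" "i < n" "\<And>w. w \<in> S \<Longrightarrow> f w = g w"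
  shows "partial_deriv i f z = partial_deriv i g z"
proof -
  have "\<forall>\<^sub>F t in nhds (z i). f (z(i := t)) = g (z(i := t))"
    using eventually_fun_upd_in[OF assms(1-3)] by eventually_elim (rule assms(4))
  then show ?thesis
    unfolding partial_deriv_def by (intro deriv_cong_ev) auto
qed

lemma smooth_on_Euclidean_iff:
  assumes "S \<subseteq> topspace (Euclidean_space n)"
  shows "smooth_on_Euclidean n S f \<longleftrightarrow>
    (\<forall>is. set is \<subseteq> {..<n} \<longrightarrow> continuous_on S (iterated_partial is f) \<and>
      (\<forall>i<n. \<forall>z\<in>S. (\<lambda>t. iterated_partial is f (z(i := t))) field_differentiable at (z i)))"
proof -
  show ?thesis
    by (simp add: smooth_on_Euclidean_def subtopology_Euclidean_space[OF assms])
qed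

lemma smooth_on_Euclidean_continuous_on:
  assumes "smooth_on_Euclidean n S f" "S \<subseteq> topspace (Euclidean_space n)"
  shows "continuous_on S f"
  using assms unfolding smooth_on_Euclidean_iff[OF assms(2)]
  by (auto dest!: spec[of _ "[]"] simp: iterated_partial_def)

lemma smooth_on_Euclidean_has_partial:
  assumes "smooth_on_Euclidean n S f" "i < n" "z \<in> S"
  shows "has_partial f i z (partial_deriv i f z)"
  using assms unfolding smooth_on_Euclidean_def
  by (intro field_differentiable_imp_has_partial)
    (auto dest!: spec[of _ "[]"] simp: iterated_partial_def)

lemma smooth_on_Euclidean_partial_deriv:
  assumes "smooth_on_Euclidean n S f" "i < n"
  shows "smooth_on_Euclidean n S (partial_deriv i f)"
proof -
  have "iterated_partial is (partial_deriv i f) = iterated_partial (is @ [i]) f" for "is"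
    by (simp add: iterated_partial_def)
  then show ?thesis
    using assms unfolding smooth_on_Euclidean_def by auto
qed

lemma smooth_on_Euclidean_subset:
  assumes "smooth_on_Euclidean n S f" "T \<subseteq> S"
  shows "smooth_on_Euclidean n T f"
proof -
  have "continuous_map (subtopology (Euclidean_space n) T) euclideanreal g"
    if "continuous_map (subtopology (Euclidean_space n) S) euclideanreal g" for g
    using that assms(2) by (metis continuous_map_from_subtopology_mono)
  then show ?thesis
    using assms unfolding smooth_on_Euclidean_def by blast
qed

section \<open>Proving smoothness coinductively\<close>

text \<open>
  Smoothness speaks of all iterated partial derivatives, which are rarely available in closed form.
  It is enough to exhibit a class \<open>F\<close> of continuous functions that contains, for each of its
  members, the partial derivatives: by induction on the list of indices, every iterated partial
  derivative of \<open>f\<close> agrees on \<open>S\<close> with a member of \<open>F\<close>.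
\<close>
lemma smooth_on_Euclidean_coinduct:
  assumes S: "openin (Euclidean_space n) S" and f: "f \<in> F"
    and cont: "\<And>g. g \<in> F \<Longrightarrow> continuous_on S g"
    and step: "\<And>g i. g \<in> F \<Longrightarrow> i < n \<Longrightarrow> \<exists>g'\<in>F. \<forall>z\<in>S. has_partial g i z (g' z)"
  shows "smooth_on_Euclidean n S f"
proof -
  have *: "\<exists>g\<in>F. \<forall>z\<in>S. iterated_partial is f z = g z" if "set is \<subseteq> {..<n}" for "is"
    using that
  proof (induction "is")
    case Nil
    then show ?case using f by (auto simp: iterated_partial_def)
  next
    case (Cons i "is")
    then obtain g where g: "g \<in> F" "\<And>z. z \<in> S \<Longrightarrow> iterated_partial is f z = g z"
      by auto
    have i: "i < n" using Cons.prems by simp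
    obtain g' where g': "g' \<in> F" "\<And>z. z \<in> S \<Longrightarrow> has_partial g i z (g' z)"
      using step[OF g(1) i] by blast
    have "iterated_partial (i # is) f z = g' z" if "z \<in> S" for z
    proof -
      have "iterated_partial (i # is) f z = partial_deriv i (iterated_partial is f) z"
        by (simp add: iterated_partial_def)
      also have "\<dots> = partial_deriv i g z"
        by (rule partial_deriv_cong[OF S that i g(2)])
      also have "\<dots> = g' z"
        by (rule has_partial_imp_partial_deriv[OF g'(2)[OF that]])
      finally show ?thesis .
    qed
    then show ?case using g'(1) by blast
  qed
  show ?thesis
    unfolding smooth_on_Euclidean_iff[OF openin_Euclidean_subset[OF S]]
  proof (intro allI impI conjI ballI)
    fix "is" assume "set is \<subseteq> {..<n}"
    then obtain g where g: "g \<in> F" "\<And>z. z \<in> S \<Longrightarrow> iterated_partial is f z = g z"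
      using * by blast
    show "continuous_on S (iterated_partial is f)"
      using cont[OF g(1)] g(2) by (simp cong: continuous_on_cong)
    fix i z assume iz: "i < n" "z \<in> S"
    obtain g' where g': "has_partial g i z (g' z)"
      using step[OF g(1) iz(1)] iz(2) by blast
    then have "has_partial (iterated_partial is f) i z (g' z)"
      using has_partial_cong[OF S iz(2,1), where f = "iterated_partial is f" and g = g] g(2) by blast
    then show "(\<lambda>t. iterated_partial is f (z(i := t))) field_differentiable at (z i)"
      by (auto simp: field_differentiable_def)
  qed
qed

text \<open>
  The product and chain rules produce sums of products.  Closing a set of functions under these
  operations lets its members have such derivatives in a coinductive smoothness proof.
\<close>
inductive function_algebra :: "(('a \<Rightarrow> real) \<Rightarrow> bool) \<Rightarrow> ('a \<Rightarrow> real) \<Rightarrow> bool"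
  for P :: "('a \<Rightarrow> real) \<Rightarrow> bool" where
  generator: "P f \<Longrightarrow> function_algebra P f"
| const: "function_algebra P (\<lambda>z. c)"
| add: "function_algebra P f \<Longrightarrow> function_algebra P g \<Longrightarrow> function_algebra P (\<lambda>z. f z + g z)"
| mult: "function_algebra P f \<Longrightarrow> function_algebra P g \<Longrightarrow> function_algebra P (\<lambda>z. f z * g z)"

lemma function_algebra_sum:
  "finite J \<Longrightarrow> (\<And>j. j \<in> J \<Longrightarrow> function_algebra P (f j)) \<Longrightarrow> function_algebra P (\<lambda>z. \<Sum>j\<in>J. f j z)"
  by (induction J rule: finite_induct)
    (auto intro: function_algebra.const function_algebra.add)

text \<open>
  If the derivatives of the generators lie in the generated algebra, then by the Leibniz rule the
  whole algebra is closed under partial derivatives, so it can take the place of \<open>F\<close> in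
  \<open>smooth_on_Euclidean_coinduct\<close>.
\<close>
lemma smooth_on_Euclidean_coinduct_algebra:
  assumes S: "openin (Euclidean_space n) S" and f: "function_algebra P f"
    and cont: "\<And>g. P g \<Longrightarrow> continuous_on S g"
    and step: "\<And>g i. P g \<Longrightarrow> i < n \<Longrightarrow>
      \<exists>g'. function_algebra P g' \<and> (\<forall>z\<in>S. has_partial g i z (g' z))"
  shows "smooth_on_Euclidean n S f"
proof (rule smooth_on_Euclidean_coinduct[OF S, where F = "Collect (function_algebra P)"])
  show "f \<in> Collect (function_algebra P)" using f by simp
next
  fix g assume "g \<in> Collect (function_algebra P)"
  then have "function_algebra P g" by simp
  then show "continuous_on S g"
    by induction (simp_all add: cont continuous_on_add continuous_on_mult)
next
  fix g i assume "g \<in> Collect (function_algebra P)" and i: "i < n"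
  then have "function_algebra P g" by simp
  then have "\<exists>g'. function_algebra P g' \<and> (\<forall>z\<in>S. has_partial g i z (g' z))"
  proof induction
    case (generator f)
    then show ?case using step i by blast
  next
    case (const c)
    show ?case
      by (intro exI[of _ "\<lambda>z. 0"]) (auto intro: function_algebra.const)
  next
    case (add f g)
    then obtain f' g' where *: "function_algebra P f'" "\<forall>z\<in>S. has_partial f i z (f' z)"
      "function_algebra P g'" "\<forall>z\<in>S. has_partial g i z (g' z)" by blast
    have "has_partial (\<lambda>z. f z + g z) i z (f' z + g' z)" if "z \<in> S" for z
      using DERIV_add[OF bspec[OF *(2) that] bspec[OF *(4) that]] .
    then show ?case
      using function_algebra.add[OF *(1,3)] by blast
  next
    case (mult f g)
    then obtain f' g' where *: "function_algebra P f'" "\<forall>z\<in>S. has_partial f i z (f' z)"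
      "function_algebra P g'" "\<forall>z\<in>S. has_partial g i z (g' z)" by blast
    have "has_partial (\<lambda>z. f z * g z) i z (f' z * g z + g' z * f z)" if "z \<in> S" for z
      using DERIV_mult[OF bspec[OF *(2) that] bspec[OF *(4) that]] by simp
    moreover have "function_algebra P (\<lambda>z. f' z * g z + g' z * f z)"
      by (rule function_algebra.add[OF function_algebra.mult[OF *(1) mult.hyps(2)]
            function_algebra.mult[OF *(3) mult.hyps(1)]])
    ultimately show ?case by blast
  qed
  then show "\<exists>g'\<in>Collect (function_algebra P). \<forall>z\<in>S. has_partial g i z (g' z)"
    by blast
qed

lemma smooth_on_Euclidean_algebra:
  assumes S: "openin (Euclidean_space n) S" and f: "function_algebra (smooth_on_Euclidean n S) f"
  shows "smooth_on_Euclidean n S f"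
  using S f
proof (rule smooth_on_Euclidean_coinduct_algebra)
  show "continuous_on S g" if "smooth_on_Euclidean n S g" for g
    using that openin_Euclidean_subset[OF S] by (rule smooth_on_Euclidean_continuous_on)
  show "\<exists>g'. function_algebra (smooth_on_Euclidean n S) g' \<and> (\<forall>z\<in>S. has_partial g i z (g' z))"
    if "smooth_on_Euclidean n S g" "i < n" for g i
    using that smooth_on_Euclidean_has_partial smooth_on_Euclidean_partial_deriv
    by (blast intro: function_algebra.generator)
qed

lemma smooth_on_Euclidean_const:
  "openin (Euclidean_space n) S \<Longrightarrow> smooth_on_Euclidean n S (\<lambda>z. c)"
  by (intro smooth_on_Euclidean_algebra function_algebra.const)

lemma smooth_on_Euclidean_add:
  "openin (Euclidean_space n) S \<Longrightarrow> smooth_on_Euclidean n S f \<Longrightarrow> smooth_on_Euclidean n S g \<Longrightarrow>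
    smooth_on_Euclidean n S (\<lambda>z. f z + g z)"
  by (rule smooth_on_Euclidean_algebra,
      assumption, rule function_algebra.add[OF function_algebra.generator function_algebra.generator])

lemma smooth_on_Euclidean_mult:
  "openin (Euclidean_space n) S \<Longrightarrow> smooth_on_Euclidean n S f \<Longrightarrow> smooth_on_Euclidean n S g \<Longrightarrow>
    smooth_on_Euclidean n S (\<lambda>z. f z * g z)"
  by (rule smooth_on_Euclidean_algebra,
      assumption, rule function_algebra.mult[OF function_algebra.generator function_algebra.generator])

lemma smooth_on_Euclidean_cong:
  assumes S: "openin (Euclidean_space n) S" and f: "smooth_on_Euclidean n S f"
    and eq: "\<And>z. z \<in> S \<Longrightarrow> g z = f z"
  shows "smooth_on_Euclidean n S g"
proof (rule smooth_on_Euclidean_coinduct[OF S, where F = "{g. \<exists>f. smooth_on_Euclidean n S f \<and> (\<forall>z\<in>S. g z = f z)}"])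
  show "g \<in> {g. \<exists>f. smooth_on_Euclidean n S f \<and> (\<forall>z\<in>S. g z = f z)}"
    using f eq by blast
  fix h assume "h \<in> {g. \<exists>f. smooth_on_Euclidean n S f \<and> (\<forall>z\<in>S. g z = f z)}"
  then obtain k where k: "smooth_on_Euclidean n S k" "\<forall>z\<in>S. h z = k z" by blast
  show "continuous_on S h"
    using smooth_on_Euclidean_continuous_on[OF k(1) openin_Euclidean_subset[OF S]] k(2)
    by (simp cong: continuous_on_cong)
  fix i assume i: "i < n"
  have "has_partial h i z (partial_deriv i k z)" if "z \<in> S" for z
    using smooth_on_Euclidean_has_partial[OF k(1) i that] has_partial_cong[OF S that i, of h k] k(2)
    by blast
  then show "\<exists>g'\<in>{g. \<exists>f. smooth_on_Euclidean n S f \<and> (\<forall>z\<in>S. g z = f z)}. \<forall>z\<in>S. has_partial h i z (g' z)"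
    using smooth_on_Euclidean_partial_deriv[OF k(1) i] by blast
qed

text \<open>
  The functions that are smooth near every point of \<open>S\<close> form a class closed under partial
  derivatives, and continuity is a local property.
\<close>
lemma smooth_on_Euclidean_locally:
  assumes S: "openin (Euclidean_space n) S"
    and loc: "\<And>z. z \<in> S \<Longrightarrow> \<exists>T. openin (Euclidean_space n) T \<and> z \<in> T \<and> smooth_on_Euclidean n T f"
  shows "smooth_on_Euclidean n S f"
proof (rule smooth_on_Euclidean_coinduct[OF S,
    where F = "{f. \<forall>z\<in>S. \<exists>T. openin (Euclidean_space n) T \<and> z \<in> T \<and> smooth_on_Euclidean n T f}"])
  let ?F = "{f. \<forall>z\<in>S. \<exists>T. openin (Euclidean_space n) T \<and> z \<in> T \<and> smooth_on_Euclidean n T f}"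
  show "f \<in> ?F" using loc by blast
  fix g assume g: "g \<in> ?F"
  show "continuous_on S g"
    unfolding continuous_on_eq_continuous_within
  proof
    fix z assume z: "z \<in> S"
    obtain T where T: "openin (Euclidean_space n) T" "z \<in> T" "smooth_on_Euclidean n T g"
      using g z by blast
    obtain V where V: "open V" "T = topspace (Euclidean_space n) \<inter> V"
      using T(1) Euclidean_space_eq_top_of_set[of n] by (metis openin_open)
    have "S \<inter> V \<subseteq> T"
      using openin_Euclidean_subset[OF S] V(2) by auto
    then have "continuous_on (S \<inter> V) g"
      using smooth_on_Euclidean_continuous_on[OF T(3) openin_Euclidean_subset[OF T(1)]]
        continuous_on_subset by blast
    then have "continuous (at z within S \<inter> V) g"
      using z T(2) V(2) by (auto simp: continuous_on_eq_continuous_within)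
    moreover have "at z within S = at z within S \<inter> V"
      using T(2) V by (intro at_within_nhd[of z V]) auto
    ultimately show "continuous (at z within S) g" by simp
  qed
  fix i assume i: "i < n"
  have "partial_deriv i g \<in> ?F"
    using g smooth_on_Euclidean_partial_deriv[OF _ i] by blast
  moreover have "\<forall>z\<in>S. has_partial g i z (partial_deriv i g z)"
    using g smooth_on_Euclidean_has_partial[OF _ i] by blast
  ultimately show "\<exists>g'\<in>?F. \<forall>z\<in>S. has_partial g i z (g' z)" by blast
qed

section \<open>The chain rule and composition\<close>

lemma increment_along_coordinate:
  fixes f f' :: "(nat \<Rightarrow> real) \<Rightarrow> real"
  assumes "\<And>s. s \<in> closed_segment (z m) b \<Longrightarrow> has_partial f m (z(m := s)) (f' (z(m := s)))"
  shows "\<exists>s\<in>closed_segment (z m) b. f (z(m := b)) - f z = (b - z m) * f' (z(m := s))"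
proof -
  define g where "g = (\<lambda>s. f (z(m := s)))"
  have g: "(g has_real_derivative f' (z(m := s))) (at s)" if "s \<in> closed_segment (z m) b" for s
    using assms[OF that] by (simp add: g_def)
  have gz: "g (z m) = f z" by (simp add: g_def)
  consider "z m < b" | "z m = b" | "b < z m" by linarith
  then have "\<exists>s\<in>closed_segment (z m) b. g b - g (z m) = (b - z m) * f' (z(m := s))"
  proof cases
    case 1
    then have "\<exists>s. z m < s \<and> s < b \<and> g b - g (z m) = (b - z m) * f' (z(m := s))"
      using g by (intro MVT2) (auto simp: closed_segment_eq_real_ivl)
    then show ?thesis using 1 by (auto simp: closed_segment_eq_real_ivl)
  next
    case 2
    then show ?thesis by auto
  next
    case 3
    then have "\<exists>s. b < s \<and> s < z m \<and> g (z m) - g b = (z m - b) * f' (z(m := s))"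
      using g by (intro MVT2) (auto simp: closed_segment_eq_real_ivl)
    then obtain s where s: "b < s" "s < z m" "g (z m) - g b = (z m - b) * f' (z(m := s))"
      by blast
    have "g b - g (z m) = (b - z m) * f' (z(m := s))"
      using s(3) by (simp add: algebra_simps)
    then show ?thesis using s 3 by (intro bexI[of _ s]) (auto simp: closed_segment_eq_real_ivl)
  qed
  then show ?thesis by (simp add: gz) (simp add: g_def)
qed

text \<open>
  The chain rule, from continuous partial derivatives alone.  The point \<open>\<gamma> a\<close> is moved to \<open>\<gamma> t\<close> one
  coordinate at a time: \<open>hyb m\<close> moves its first \<open>m\<close> coordinates along \<open>\<gamma>\<close> and keeps the others at
  \<open>\<gamma> a\<close>.  From \<open>hyb m\<close> to \<open>hyb (Suc m)\<close> only coordinate \<open>m\<close> changes, and the mean value theorem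
  turns the increment of \<open>f\<close> into \<open>\<gamma> t m - \<gamma> a m\<close> times a value of \<open>f' m\<close> at a point \<open>\<xi> t\<close> that
  tends to \<open>\<gamma> a\<close>.
\<close>
lemma has_real_derivative_along_curve:
  fixes \<gamma> :: "real \<Rightarrow> nat \<Rightarrow> real"
  assumes S: "openin (Euclidean_space n) S"
    and f: "\<And>j z. j < n \<Longrightarrow> z \<in> S \<Longrightarrow> has_partial f j z (f' j z)"
    and cont: "\<And>j. j < n \<Longrightarrow> continuous_on S (f' j)"
    and c: "\<gamma> a \<in> S"
    and ev: "\<forall>\<^sub>F t in nhds a. \<gamma> t \<in> topspace (Euclidean_space n)"
    and \<gamma>: "\<And>j. j < n \<Longrightarrow> ((\<lambda>t. \<gamma> t j) has_real_derivative \<gamma>' j) (at a)"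
  shows "((\<lambda>t. f (\<gamma> t)) has_real_derivative (\<Sum>j<n. f' j (\<gamma> a) * \<gamma>' j)) (at a)"
proof -
  define hyb where "hyb = (\<lambda>m t j. if j < m then \<gamma> t j else \<gamma> a j)"
  obtain d0 where d0: "0 < d0" "cube n (\<gamma> a) d0 \<subseteq> S"
    using cube_subset_openin[OF S c] by blast
  have ca: "\<And>j. j \<ge> n \<Longrightarrow> \<gamma> a j = 0"
    using c openin_Euclidean_subset[OF S] by (auto simp: topspace_Euclidean_space)
  have near: "\<forall>\<^sub>F t in at a. \<forall>j<n. \<bar>\<gamma> t j - \<gamma> a j\<bar> < d" if "0 < d" for d
  proof -
    have "\<forall>\<^sub>F t in at a. \<bar>\<gamma> t j - \<gamma> a j\<bar> < d" if "j < n" for j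
      using DERIV_isCont[OF \<gamma>[OF that]] \<open>0 < d\<close>
      by (auto simp: isCont_def tendsto_iff dist_real_def)
    then have "\<forall>\<^sub>F t in at a. \<forall>j\<in>{..<n}. \<bar>\<gamma> t j - \<gamma> a j\<bar> < d"
      by (intro eventually_ball_finite) auto
    then show ?thesis by (simp add: Ball_def)
  qed
  have *: "((\<lambda>t. f (hyb m t)) has_real_derivative (\<Sum>j<m. f' j (\<gamma> a) * \<gamma>' j)) (at a)"
    if "m \<le> n" for m
    using that
  proof (induction m)
    case 0
    then show ?case by (simp add: hyb_def)
  next
    case (Suc m)
    then have m: "m < n" by simp
    define R where "R = (\<lambda>t. f (hyb (Suc m) t) - f (hyb m t))"
    have hyb_Suc: "hyb (Suc m) t = (hyb m t)(m := \<gamma> t m)" for t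
      by (auto simp: hyb_def less_Suc_eq)
    have hyb_m: "hyb m t m = \<gamma> a m" for t by (simp add: hyb_def)
    have "\<exists>\<xi>. (\<forall>j<n. \<bar>\<gamma> t j - \<gamma> a j\<bar> < d0) \<longrightarrow> \<xi> \<in> topspace (Euclidean_space n) \<and>
        (\<forall>j<n. \<bar>\<xi> j - \<gamma> a j\<bar> \<le> \<bar>\<gamma> t j - \<gamma> a j\<bar>) \<and> R t = (\<gamma> t m - \<gamma> a m) * f' m \<xi>" for t
    proof (cases "\<forall>j<n. \<bar>\<gamma> t j - \<gamma> a j\<bar> < d0")
      case True
      have seg: "(hyb m t)(m := s) \<in> topspace (Euclidean_space n) \<and>
          (\<forall>j<n. \<bar>((hyb m t)(m := s)) j - \<gamma> a j\<bar> \<le> \<bar>\<gamma> t j - \<gamma> a j\<bar>)"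
        if "s \<in> closed_segment (\<gamma> a m) (\<gamma> t m)" for s
        using that m ca
        by (auto simp: hyb_def topspace_Euclidean_space closed_segment_eq_real_ivl split: if_splits)
      have "\<exists>s\<in>closed_segment (hyb m t m) (\<gamma> t m).
          f ((hyb m t)(m := \<gamma> t m)) - f (hyb m t) = (\<gamma> t m - hyb m t m) * f' m ((hyb m t)(m := s))"
      proof (rule increment_along_coordinate)
        fix s assume "s \<in> closed_segment (hyb m t m) (\<gamma> t m)"
        then have "s \<in> closed_segment (\<gamma> a m) (\<gamma> t m)"
          by (simp only: hyb_m)
        from seg[OF this] have "(hyb m t)(m := s) \<in> cube n (\<gamma> a) d0"
          using True unfolding cube_def by (blast intro: le_less_trans)
        then show "has_partial f m ((hyb m t)(m := s)) (f' m ((hyb m t)(m := s)))"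
          using d0(2) by (intro f m) auto
      qed
      then show ?thesis
        unfolding hyb_m R_def hyb_Suc using seg by blast
    qed auto
    then obtain \<xi> where \<xi>: "\<And>t. (\<forall>j<n. \<bar>\<gamma> t j - \<gamma> a j\<bar> < d0) \<Longrightarrow> \<xi> t \<in> topspace (Euclidean_space n) \<and>
        (\<forall>j<n. \<bar>\<xi> t j - \<gamma> a j\<bar> \<le> \<bar>\<gamma> t j - \<gamma> a j\<bar>) \<and> R t = (\<gamma> t m - \<gamma> a m) * f' m (\<xi> t)"
      by metis
    have "((\<lambda>t. f' m (\<xi> t)) \<longlongrightarrow> f' m (\<gamma> a)) (at a)"
      unfolding tendsto_iff
    proof (intro allI impI)
      fix e :: real assume "0 < e"
      \<comment> \<open>\<open>\<xi> t\<close> is at least as close to \<open>\<gamma> a\<close> as \<open>\<gamma> t\<close> in every coordinate\<close>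
      have "openin (top_of_set S) (S \<inter> f' m -` ball (f' m (\<gamma> a)) e)"
        using cont[OF m] by (auto simp: continuous_on_open_invariant intro: continuous_openin_preimage_gen)
      then have "openin (Euclidean_space n) (S \<inter> f' m -` ball (f' m (\<gamma> a)) e)"
        using S Euclidean_space_eq_top_of_set[of n]
        by (metis openin_trans_full openin_trans)
      then obtain d where d: "0 < d" "cube n (\<gamma> a) d \<subseteq> S \<inter> f' m -` ball (f' m (\<gamma> a)) e"
        using cube_subset_openin[of n _ "\<gamma> a"] c \<open>0 < e\<close> by (metis IntI centre_in_ball vimage_eq)
      show "\<forall>\<^sub>F t in at a. dist (f' m (\<xi> t)) (f' m (\<gamma> a)) < e"
        using near[OF d0(1)] near[OF d(1)]
      proof eventually_elim
        case (elim t)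
        then have "\<xi> t \<in> cube n (\<gamma> a) d"
          using \<xi>[OF elim(1)] by (auto simp: cube_def intro: le_less_trans)
        then show ?case using d(2) by (auto simp: dist_commute)
      qed
    qed
    moreover have "((\<lambda>t. (\<gamma> t m - \<gamma> a m) / (t - a)) \<longlongrightarrow> \<gamma>' m) (at a)"
      using \<gamma>[OF m] by (simp add: has_field_derivative_iff)
    ultimately have lim: "((\<lambda>t. f' m (\<xi> t) * ((\<gamma> t m - \<gamma> a m) / (t - a))) \<longlongrightarrow> f' m (\<gamma> a) * \<gamma>' m) (at a)"
      by (rule tendsto_mult)
    have Ra: "R a = 0" by (simp add: R_def hyb_def)
    have "\<forall>\<^sub>F t in at a. f' m (\<xi> t) * ((\<gamma> t m - \<gamma> a m) / (t - a)) = (R t - R a) / (t - a)"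
      using near[OF d0(1)]
    proof eventually_elim
      case (elim t)
      show ?case using \<xi>[OF elim] Ra by simp
    qed
    then have "(R has_real_derivative f' m (\<gamma> a) * \<gamma>' m) (at a)"
      unfolding has_field_derivative_iff using lim by (rule Lim_transform_eventually[rotated])
    from DERIV_add[OF Suc.IH this] m show ?case
      by (simp add: R_def)
  qed
  have "\<forall>\<^sub>F t in nhds a. f (hyb n t) = f (\<gamma> t)"
    using ev
  proof eventually_elim
    case (elim t)
    have "hyb n t = \<gamma> t"
      using elim ca by (auto simp: hyb_def topspace_Euclidean_space fun_eq_iff)
    then show ?case by simp
  qed
  then show ?thesis
    using *[OF order_refl] by (subst (asm) DERIV_cong_ev[OF refl _ refl]) auto
qed

lemma smooth_on_Euclidean_curve:
  assumes "openin (Euclidean_space n) S" "smooth_on_Euclidean n S f" "\<gamma> a \<in> S"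
    "\<forall>\<^sub>F t in nhds a. \<gamma> t \<in> topspace (Euclidean_space n)"
    "\<And>j. j < n \<Longrightarrow> ((\<lambda>t. \<gamma> t j) has_real_derivative \<gamma>' j) (at a)"
  shows "((\<lambda>t. f (\<gamma> t)) has_real_derivative (\<Sum>j<n. partial_deriv j f (\<gamma> a) * \<gamma>' j)) (at a)"
proof (rule has_real_derivative_along_curve[OF assms(1) _ _ assms(3-5)])
  show "has_partial f j z (partial_deriv j f z)" if "j < n" "z \<in> S" for j z
    using assms(2) that by (rule smooth_on_Euclidean_has_partial)
  show "continuous_on S (partial_deriv j f)" if "j < n" for j
    using smooth_on_Euclidean_partial_deriv[OF assms(2) that] openin_Euclidean_subset[OF assms(1)]
    by (rule smooth_on_Euclidean_continuous_on)
qed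

text \<open>
  The partial derivatives of \<open>h \<circ> \<phi>\<close> are sums of products of functions \<open>h' \<circ> \<phi>\<close> with smooth
  functions, so the composites with \<open>\<phi>\<close> together with the smooth functions generate an algebra
  closed under partial derivatives.
\<close>
lemma smooth_on_Euclidean_compose:
  assumes S: "openin (Euclidean_space n) S" and T: "openin (Euclidean_space k) T"
    and f: "smooth_on_Euclidean k T f"
    and \<phi>: "\<And>j. j < k \<Longrightarrow> smooth_on_Euclidean n S (\<lambda>z. \<phi> z j)"
    and into: "\<And>z. z \<in> S \<Longrightarrow> \<phi> z \<in> T"
  shows "smooth_on_Euclidean n S (\<lambda>z. f (\<phi> z))"
proof -
  define P where "P = (\<lambda>g. smooth_on_Euclidean n S g \<or>
    (\<exists>h. smooth_on_Euclidean k T h \<and> g = (\<lambda>z. h (\<phi> z))))"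
  have contS: "continuous_on S g" if "smooth_on_Euclidean n S g" for g
    using that openin_Euclidean_subset[OF S] by (rule smooth_on_Euclidean_continuous_on)
  have \<phi>T: "\<phi> z \<in> topspace (Euclidean_space k)" if "z \<in> S" for z
    using into[OF that] openin_Euclidean_subset[OF T] by blast
  have "continuous_on S (\<lambda>z. \<phi> z j)" for j
  proof (cases "j < k")
    case True
    then show ?thesis by (intro contS \<phi>)
  next
    case False
    then have "\<phi> z j = 0" if "z \<in> S" for z
      using \<phi>T[OF that] by (simp add: topspace_Euclidean_space)
    then show ?thesis by (simp cong: continuous_on_cong)
  qed
  then have cont\<phi>: "continuous_on S \<phi>"
    by (rule continuous_on_coordinatewise_then_product)
  show ?thesis
  proof (rule smooth_on_Euclidean_coinduct_algebra[OF S, where P = P])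
    show "function_algebra P (\<lambda>z. f (\<phi> z))"
      using f by (auto simp: P_def intro!: function_algebra.generator)
  next
    fix g assume "P g"
    then show "continuous_on S g"
      unfolding P_def
    proof (elim disjE exE conjE)
      fix h assume h: "smooth_on_Euclidean k T h" "g = (\<lambda>z. h (\<phi> z))"
      show "continuous_on S g"
        unfolding h(2)
        by (rule continuous_on_compose2[OF smooth_on_Euclidean_continuous_on[OF h(1)
              openin_Euclidean_subset[OF T]] cont\<phi>]) (use into in blast)
    qed (rule contS)
  next
    fix g i assume "P g" and i: "i < n"
    then have "smooth_on_Euclidean n S g \<or> (\<exists>h. smooth_on_Euclidean k T h \<and> g = (\<lambda>z. h (\<phi> z)))"
      by (simp add: P_def)
    then show "\<exists>g'. function_algebra P g' \<and> (\<forall>z\<in>S. has_partial g i z (g' z))"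
    proof (elim disjE exE conjE)
      assume "smooth_on_Euclidean n S g"
      then have "function_algebra P (partial_deriv i g)"
          "\<forall>z\<in>S. has_partial g i z (partial_deriv i g z)"
        using smooth_on_Euclidean_has_partial smooth_on_Euclidean_partial_deriv i
        by (simp_all add: P_def function_algebra.generator)
      then show ?thesis by blast
    next
      fix h assume h: "smooth_on_Euclidean k T h" "g = (\<lambda>z. h (\<phi> z))"
      define g' where "g' = (\<lambda>z. \<Sum>j<k. partial_deriv j h (\<phi> z) * partial_deriv i (\<lambda>z. \<phi> z j) z)"
      have "function_algebra P g'"
        unfolding g'_def
      proof (rule function_algebra_sum)
        fix j assume "j \<in> {..<k}"
        then have j: "j < k" by simp
        show "function_algebra P (\<lambda>z. partial_deriv j h (\<phi> z) * partial_deriv i (\<lambda>z. \<phi> z j) z)"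
        proof (rule function_algebra.mult)
          show "function_algebra P (\<lambda>z. partial_deriv j h (\<phi> z))"
            using smooth_on_Euclidean_partial_deriv[OF h(1) j]
            by (intro function_algebra.generator) (auto simp: P_def)
          show "function_algebra P (partial_deriv i (\<lambda>z. \<phi> z j))"
            using smooth_on_Euclidean_partial_deriv[OF \<phi>[OF j] i]
            by (intro function_algebra.generator) (auto simp: P_def)
        qed
      qed simp
      moreover have "has_partial g i z (g' z)" if z: "z \<in> S" for z
      proof -
        have "((\<lambda>t. h (\<phi> (z(i := t)))) has_real_derivative
            (\<Sum>j<k. partial_deriv j h (\<phi> (z(i := z i))) * partial_deriv i (\<lambda>z. \<phi> z j) z)) (at (z i))"
        proof (rule smooth_on_Euclidean_curve[OF T h(1)])
          show "\<phi> (z(i := z i)) \<in> T" using into z by simp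
          show "\<forall>\<^sub>F t in nhds (z i). \<phi> (z(i := t)) \<in> topspace (Euclidean_space k)"
            using eventually_fun_upd_in[OF S z i] by eventually_elim (rule \<phi>T)
          show "((\<lambda>t. \<phi> (z(i := t)) j) has_real_derivative partial_deriv i (\<lambda>z. \<phi> z j) z) (at (z i))"
            if "j < k" for j
            using smooth_on_Euclidean_has_partial[OF \<phi>[OF that] i z] .
        qed
        then show ?thesis by (simp add: h(2) g'_def)
      qed
      ultimately show ?thesis by blast
    qed
  qed
qed

text \<open>
  Composition with a function of one real variable that belongs to a family closed under
  derivatives.  It is applied to the multiples of negative powers and to the flat functions below.
\<close>
lemma smooth_on_Euclidean_compose_real:
  fixes H :: "(real \<Rightarrow> real) set"
  assumes S: "openin (Euclidean_space n) S" and f: "smooth_on_Euclidean n S f"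
    and J: "\<And>z. z \<in> S \<Longrightarrow> f z \<in> J" and h: "h \<in> H"
    and H: "\<And>h. h \<in> H \<Longrightarrow> \<exists>h'\<in>H. \<forall>t\<in>J. (h has_real_derivative h' t) (at t)"
  shows "smooth_on_Euclidean n S (\<lambda>z. h (f z))"
proof -
  define P where "P = (\<lambda>g. smooth_on_Euclidean n S g \<or> (\<exists>h\<in>H. g = (\<lambda>z. h (f z))))"
  have contS: "continuous_on S g" if "smooth_on_Euclidean n S g" for g
    using that openin_Euclidean_subset[OF S] by (rule smooth_on_Euclidean_continuous_on)
  show ?thesis
  proof (rule smooth_on_Euclidean_coinduct_algebra[OF S, where P = P])
    show "function_algebra P (\<lambda>z. h (f z))"
      using h by (auto simp: P_def intro!: function_algebra.generator)
  next
    fix g assume "P g"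
    then show "continuous_on S g"
      unfolding P_def
    proof (elim disjE bexE)
      fix h assume h: "h \<in> H" "g = (\<lambda>z. h (f z))"
      have "continuous_on J h"
        using H[OF h(1)] by (meson DERIV_isCont continuous_at_imp_continuous_on)
      then show "continuous_on S g"
        unfolding h(2) by (rule continuous_on_compose2[OF _ contS[OF f]]) (use J in auto)
    qed (rule contS)
  next
    fix g i assume "P g" and i: "i < n"
    then have "smooth_on_Euclidean n S g \<or> (\<exists>h\<in>H. g = (\<lambda>z. h (f z)))"
      by (simp add: P_def)
    then show "\<exists>g'. function_algebra P g' \<and> (\<forall>z\<in>S. has_partial g i z (g' z))"
    proof (elim disjE bexE)
      assume "smooth_on_Euclidean n S g"
      then have "function_algebra P (partial_deriv i g)"
          "\<forall>z\<in>S. has_partial g i z (partial_deriv i g z)"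
        using smooth_on_Euclidean_has_partial smooth_on_Euclidean_partial_deriv i
        by (simp_all add: P_def function_algebra.generator)
      then show ?thesis by blast
    next
      fix h assume h: "h \<in> H" "g = (\<lambda>z. h (f z))"
      obtain h' where h': "h' \<in> H" "\<And>t. t \<in> J \<Longrightarrow> (h has_real_derivative h' t) (at t)"
        using H[OF h(1)] by blast
      have "function_algebra P (\<lambda>z. h' (f z) * partial_deriv i f z)"
        using h'(1) smooth_on_Euclidean_partial_deriv[OF f i]
        by (intro function_algebra.mult function_algebra.generator) (auto simp: P_def)
      moreover have "has_partial g i z (h' (f z) * partial_deriv i f z)" if "z \<in> S" for z
        unfolding h(2)
        using h'(2)[OF J[OF that]] smooth_on_Euclidean_has_partial[OF f i that]
        by (intro DERIV_chain2[of h]) simp_all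
      ultimately show ?thesis by blast
    qed
  qed
qed

lemma smooth_on_Euclidean_inverse:
  assumes S: "openin (Euclidean_space n) S" and f: "smooth_on_Euclidean n S f"
    and nz: "\<And>z. z \<in> S \<Longrightarrow> f z \<noteq> 0"
  shows "smooth_on_Euclidean n S (\<lambda>z. inverse (f z))"
proof (rule smooth_on_Euclidean_compose_real[OF S f, where J = "- {0}"
      and H = "range (\<lambda>(c, m) t. c / t ^ Suc m)"])
  show "inverse \<in> range (\<lambda>(c, m) t::real. c / t ^ Suc m)"
    by (rule image_eqI[of _ _ "(1, 0)"]) (auto simp: field_simps)
  fix h assume "h \<in> range (\<lambda>(c, m) t::real. c / t ^ Suc m)"
  then obtain c m where h: "h = (\<lambda>t::real. c / t ^ Suc m)" by auto
  have "(h has_real_derivative (- (c * (1 + m))) / t ^ Suc (Suc m)) (at t)" if "t \<noteq> 0" for t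
  proof -
    have "((\<lambda>t. t ^ Suc m) has_real_derivative (1 + real m) * t ^ m) (at t)"
      using DERIV_pow[of "Suc m" t UNIV] by simp
    from DERIV_divide[OF DERIV_const this, of c]
    have "(h has_real_derivative
        (0 * t ^ Suc m - c * ((1 + real m) * t ^ m)) / (t ^ Suc m * t ^ Suc m)) (at t)"
      unfolding h using that by simp
    moreover have "(0 * t ^ Suc m - c * ((1 + real m) * t ^ m)) / (t ^ Suc m * t ^ Suc m) =
        (- (c * (1 + m))) / t ^ Suc (Suc m)"
      using that by (simp add: field_simps)
    ultimately show ?thesis by simp
  qed
  then have "\<forall>t\<in>- {0}. (h has_real_derivative
      (\<lambda>(c, m) t. c / t ^ Suc m) (- (c * (1 + m)), Suc m) t) (at t)"
    by simp
  then show "\<exists>h'\<in>range (\<lambda>(c, m) t. c / t ^ Suc m). \<forall>t\<in>- {0}. (h has_real_derivative h' t) (at t)"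
    by blast
qed (use nz in auto)

section \<open>Bump functions\<close>

text \<open>
  The functions \<open>q(1/t) exp(-1/t)\<close> for \<open>t > 0\<close>, extended by zero.  All polynomials \<open>q\<close> are taken
  together because differentiation only changes \<open>q\<close>; in particular the classical smooth function
  \<open>exp(-1/t)\<close>, the case \<open>q = 1\<close>, has derivatives of all orders.
\<close>
definition flat_function :: "real poly \<Rightarrow> real \<Rightarrow> real" where
  "flat_function q t = (if t \<le> 0 then 0 else poly q (inverse t) * exp (- inverse t))"

lemma tendsto_power_poly_exp_at_top:
  "((\<lambda>s::real. s ^ k * poly q s * exp (- s)) \<longlongrightarrow> 0) at_top"
proof (induction q arbitrary: k)
  case 0
  then show ?case by simp
next
  case (pCons a q)
  have "((\<lambda>s. a * (s ^ k / exp s) + s ^ Suc k * poly q s * exp (- s)) \<longlongrightarrow> a * 0 + 0) at_top"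
    by (intro tendsto_intros tendsto_power_div_exp_0 pCons.IH)
  then show ?case by (simp add: algebra_simps exp_minus field_class.field_divide_inverse)
qed

lemma flat_function_has_derivative:
  "(flat_function q has_real_derivative flat_function ((q - pderiv q) * [:0, 0, 1:]) t) (at t)"
proof -
  consider "t < 0" | "t = 0" | "0 < t" by linarith
  then show ?thesis
  proof cases
    case 1
    have "\<forall>\<^sub>F u in nhds t. u < 0"
      using 1 by (intro eventually_nhds_in_open[of "{..<0}" t, simplified])
    then have "\<forall>\<^sub>F u in nhds t. flat_function q u = 0"
      by eventually_elim (simp add: flat_function_def)
    then show ?thesis
      using 1 by (subst DERIV_cong_ev[OF refl _ refl]) (auto simp: flat_function_def)
  next
    case 2
    have "((\<lambda>u. inverse u ^ 1 * poly q (inverse u) * exp (- inverse u)) \<longlongrightarrow> 0) (at_right (0::real))"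
      by (rule filterlim_compose[OF tendsto_power_poly_exp_at_top filterlim_inverse_at_top_right])
    then have "((\<lambda>u. (flat_function q u - flat_function q 0) / (u - 0)) \<longlongrightarrow> 0) (at_right 0)"
    proof (rule Lim_transform_eventually)
      have "\<forall>\<^sub>F u in at_right (0::real). 0 < u"
        by (simp add: eventually_at_right_less)
      then show "\<forall>\<^sub>F u in at_right 0. inverse u ^ 1 * poly q (inverse u) * exp (- inverse u) =
          (flat_function q u - flat_function q 0) / (u - 0)"
        by eventually_elim (simp add: flat_function_def field_class.field_divide_inverse)
    qed
    moreover have "((\<lambda>u. (flat_function q u - flat_function q 0) / (u - 0)) \<longlongrightarrow> 0) (at_left 0)"
    proof (rule Lim_transform_eventually[OF tendsto_const])
      have "\<forall>\<^sub>F u in at_left (0::real). u < 0"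
        by (auto simp: eventually_at_filter)
      then show "\<forall>\<^sub>F u in at_left 0. 0 = (flat_function q u - flat_function q 0) / (u - 0)"
        by eventually_elim (simp add: flat_function_def)
    qed
    ultimately show ?thesis
      using 2 by (simp add: has_field_derivative_iff filterlim_split_at flat_function_def)
  next
    case 3
    have "\<forall>\<^sub>F u in nhds t. 0 < u"
      using 3 by (intro eventually_nhds_in_open[of "{0<..}" t, simplified])
    then have ev: "\<forall>\<^sub>F u in nhds t. flat_function q u = poly q (inverse u) * exp (- inverse u)"
      by eventually_elim (simp add: flat_function_def)
    have "((\<lambda>u. poly q (inverse u) * exp (- inverse u)) has_real_derivative
        flat_function ((q - pderiv q) * [:0, 0, 1:]) t) (at t)"
      using 3 by (auto intro!: derivative_eq_intros DERIV_chain2[OF poly_DERIV]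
          simp: flat_function_def power2_eq_square field_simps)
    then show ?thesis
      by (subst DERIV_cong_ev[OF refl ev refl])
  qed
qed

lemma smooth_on_Euclidean_flat_function:
  assumes "openin (Euclidean_space n) S" "smooth_on_Euclidean n S f"
  shows "smooth_on_Euclidean n S (\<lambda>z. flat_function q (f z))"
  by (rule smooth_on_Euclidean_compose_real[OF assms, where J = UNIV and H = "range flat_function"])
    (use flat_function_has_derivative in blast)+

text \<open>
  A smooth transition from 0 on \<open>t \<le> 0\<close> to 1 on \<open>t \<ge> 1\<close>: the two flat functions never vanish at
  the same point, so the quotient is smooth, and outside the open unit interval one of them does.
\<close>
definition smooth_step :: "real \<Rightarrow> real" where
  "smooth_step t = flat_function 1 t * inverse (flat_function 1 t + flat_function 1 (1 - t))"

lemma flat_function_denominator_pos: "0 < flat_function 1 t + flat_function 1 (1 - t)"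
  by (auto simp: flat_function_def add_pos_pos)

lemma smooth_step_eq_0: "t \<le> 0 \<Longrightarrow> smooth_step t = 0"
  by (simp add: smooth_step_def flat_function_def)

lemma smooth_step_eq_1: "1 \<le> t \<Longrightarrow> smooth_step t = 1"
  by (simp add: smooth_step_def flat_function_def)

lemma smooth_on_Euclidean_smooth_step:
  assumes S: "openin (Euclidean_space n) S" and f: "smooth_on_Euclidean n S f"
  shows "smooth_on_Euclidean n S (\<lambda>z. smooth_step (f z))"
proof -
  have "smooth_on_Euclidean n S (\<lambda>z. 1 + (- 1) * f z)"
    by (rule smooth_on_Euclidean_add[OF S smooth_on_Euclidean_const[OF S]
          smooth_on_Euclidean_mult[OF S smooth_on_Euclidean_const[OF S] f]])
  then have "smooth_on_Euclidean n S (\<lambda>z. 1 - f z)"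
    by simp
  then have flat': "smooth_on_Euclidean n S (\<lambda>z. flat_function 1 (1 - f z))"
    by (rule smooth_on_Euclidean_flat_function[OF S])
  have flat: "smooth_on_Euclidean n S (\<lambda>z. flat_function 1 (f z))"
    by (rule smooth_on_Euclidean_flat_function[OF S f])
  have "smooth_on_Euclidean n S (\<lambda>z. inverse (flat_function 1 (f z) + flat_function 1 (1 - f z)))"
    by (rule smooth_on_Euclidean_inverse[OF S smooth_on_Euclidean_add[OF S flat flat']])
      (rule flat_function_denominator_pos[THEN less_imp_neq, THEN not_sym])
  from smooth_on_Euclidean_mult[OF S flat this] show ?thesis
    by (simp add: smooth_step_def)
qed

lemma smooth_on_Euclidean_prod:
  assumes S: "openin (Euclidean_space n) S" and "finite J" "\<And>j. j \<in> J \<Longrightarrow> smooth_on_Euclidean n S (f j)"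
  shows "smooth_on_Euclidean n S (\<lambda>z. \<Prod>j\<in>J. f j z)"
  using assms(2,3)
  by (induction J rule: finite_induct)
    (auto intro: smooth_on_Euclidean_const[OF S] smooth_on_Euclidean_mult[OF S])

lemma smooth_on_Euclidean_coordinate:
  assumes S: "openin (Euclidean_space n) S"
  shows "smooth_on_Euclidean n S (\<lambda>z. z j)"
proof (rule smooth_on_Euclidean_coinduct_algebra[OF S, where P = "\<lambda>g. g = (\<lambda>z. z j)"])
  fix g :: "(nat \<Rightarrow> real) \<Rightarrow> real" and i assume g: "g = (\<lambda>z. z j)"
  have "has_partial g i z (if i = j then 1 else 0)" for z
    unfolding g by auto
  then show "\<exists>g'. function_algebra (\<lambda>g. g = (\<lambda>z. z j)) g' \<and> (\<forall>z\<in>S. has_partial g i z (g' z))"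
    using function_algebra.const[of _ "if i = j then 1 else 0"] by blast
qed (auto intro: function_algebra.generator continuous_on_subset[OF continuous_on_product_coordinates])

text \<open>
  Equal to 1 on the cube of radius \<open>d\<close> around \<open>c\<close>, and to 0 as soon as one coordinate is at
  distance at least \<open>3/2 d\<close> from that of \<open>c\<close>, because \<open>3/2\<close> exceeds the square root of 2.  Squares keep
  the argument of the step function smooth, and the product over coordinates avoids norms.
\<close>
definition bump :: "nat \<Rightarrow> (nat \<Rightarrow> real) \<Rightarrow> real \<Rightarrow> (nat \<Rightarrow> real) \<Rightarrow> real" where
  "bump n c d z = (\<Prod>i<n. smooth_step (2 - ((z i - c i) / d)\<^sup>2))"

lemma smooth_on_Euclidean_bump:
  assumes S: "openin (Euclidean_space n) S"
  shows "smooth_on_Euclidean n S (bump n c d)"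
proof -
  have aux: "smooth_on_Euclidean n S (\<lambda>z. (z i + - c i) * inverse d)" for i
    by (rule smooth_on_Euclidean_mult[OF S smooth_on_Euclidean_add[OF S
          smooth_on_Euclidean_coordinate[OF S] smooth_on_Euclidean_const[OF S]]
          smooth_on_Euclidean_const[OF S]])
  have "smooth_on_Euclidean n S (\<lambda>z. 2 + (-1) * (((z i + - c i) * inverse d) * ((z i + - c i) * inverse d)))" for i
    by (rule smooth_on_Euclidean_add[OF S smooth_on_Euclidean_const[OF S]
          smooth_on_Euclidean_mult[OF S smooth_on_Euclidean_const[OF S]
          smooth_on_Euclidean_mult[OF S aux aux]]])
  then have "smooth_on_Euclidean n S (\<lambda>z. 2 - ((z i - c i) / d)\<^sup>2)" for i
    by (simp add: power2_eq_square field_class.field_divide_inverse)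
  then have "smooth_on_Euclidean n S (\<lambda>z. \<Prod>i<n. smooth_step (2 - ((z i - c i) / d)\<^sup>2))"
    by (intro smooth_on_Euclidean_prod[OF S] smooth_on_Euclidean_smooth_step[OF S]) auto
  then show ?thesis
    by (simp add: bump_def[abs_def])
qed

lemma bump_eq_1:
  assumes "0 < d" "z \<in> cube n c d"
  shows "bump n c d z = 1"
  unfolding bump_def
proof (rule prod.neutral, rule ballI)
  fix i assume "i \<in> {..<n}"
  then have "\<bar>(z i - c i) / d\<bar> < 1"
    using assms by (auto simp: cube_def)
  then have "((z i - c i) / d)\<^sup>2 < 1"
    by (simp only: abs_square_less_1)
  then show "smooth_step (2 - ((z i - c i) / d)\<^sup>2) = 1"
    by (intro smooth_step_eq_1) simp
qed

lemma bump_eq_0: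
  assumes "0 < d" "i < n" "3 / 2 * d \<le> \<bar>z i - c i\<bar>"
  shows "bump n c d z = 0"
proof -
  define r where "r = (z i - c i) / d"
  have "3 / 2 \<le> \<bar>r\<bar>"
    using assms by (simp add: r_def field_simps)
  then have "(3 / 2)\<^sup>2 \<le> \<bar>r\<bar>\<^sup>2"
    by (intro power_mono) auto
  then have "smooth_step (2 - r\<^sup>2) = 0"
    by (intro smooth_step_eq_0) (simp add: power2_eq_square)
  then show ?thesis
    unfolding bump_def r_def using assms(2) by (intro prod_zero) auto
qed

section \<open>Hadamard's lemma\<close>

text \<open>
  Differentiating under the integral sign brings out one more factor \<open>t\<close> and a partial derivative of
  \<open>f\<close>.  The family of these integrals, for all exponents \<open>m\<close> and all smooth \<open>f\<close>, is therefore closed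
  under partial derivatives.
\<close>
lemma smooth_on_Euclidean_radial_integral:
  assumes c: "c \<in> topspace (Euclidean_space n)" and "0 < d" and f: "smooth_on_Euclidean n (cube n c d) f"
  shows "smooth_on_Euclidean n (cube n c d)
    (\<lambda>z. integral {0..1} (\<lambda>t. t ^ m * f (\<lambda>j. c j + t * (z j - c j))))"
proof -
  define Q where "Q = cube n c d"
  define pt where "pt = (\<lambda>z t j. c j + t * (z j - c j) :: real)"
  have Q: "openin (Euclidean_space n) Q" by (simp add: Q_def openin_cube)
  have pt_Q: "pt z t \<in> Q" if "z \<in> Q" "t \<in> {0..1}" for z t
  proof -
    have pt_0: "pt z t j = 0" if "j \<ge> n" for j
      using that \<open>z \<in> Q\<close> c by (simp add: pt_def Q_def cube_def topspace_Euclidean_space)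
    have "\<bar>t * (z j - c j)\<bar> \<le> \<bar>z j - c j\<bar>" for j
      using that(2) by (simp add: abs_mult mult_left_le_one_le)
    moreover have "\<bar>z j - c j\<bar> < d" if "j < n" for j
      using \<open>z \<in> Q\<close> that by (simp add: Q_def cube_def)
    ultimately have "\<bar>pt z t j - c j\<bar> < d" if "j < n" for j
      using that le_less_trans by (fastforce simp: pt_def)
    with pt_0 show ?thesis
      by (simp add: Q_def cube_def topspace_Euclidean_space)
  qed
  have cont_pt: "continuous_on X (\<lambda>x. pt (fst x) (snd x))" for X
    unfolding pt_def
    by (intro continuous_on_coordinatewise_then_product continuous_intros
        continuous_on_product_then_coordinatewise[OF continuous_on_fst[OF continuous_on_id]])
  have cont_h: "continuous_on (Q \<times> {0..1}) (\<lambda>x. h (pt (fst x) (snd x)))"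
    if "smooth_on_Euclidean n Q h" for h
    by (rule continuous_on_compose2[OF smooth_on_Euclidean_continuous_on[OF that
            openin_Euclidean_subset[OF Q]] cont_pt]) (use pt_Q in auto)
  have cont_int: "continuous_on (Q \<times> {0..1}) (\<lambda>x. snd x ^ m * h (pt (fst x) (snd x)))"
    if "smooth_on_Euclidean n Q h" for h m
    by (intro continuous_intros cont_h that)
  define F where "F = {g. \<exists>h m. smooth_on_Euclidean n Q h \<and>
      g = (\<lambda>z. integral {0..1} (\<lambda>t. t ^ m * h (pt z t)))}"
  have "smooth_on_Euclidean n Q (\<lambda>z. integral {0..1} (\<lambda>t. t ^ m * f (pt z t)))"
  proof (rule smooth_on_Euclidean_coinduct[OF Q, where F = F])
    show "(\<lambda>z. integral {0..1} (\<lambda>t. t ^ m * f (pt z t))) \<in> F"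
      using f unfolding F_def Q_def by blast
  next
    fix g assume "g \<in> F"
    then obtain h m where h: "smooth_on_Euclidean n Q h"
        "g = (\<lambda>z. integral {0..1} (\<lambda>t. t ^ m * h (pt z t)))"
      unfolding F_def by blast
    show "continuous_on Q g"
      unfolding h(2) using integral_continuous_on_param[of Q 0 1 "\<lambda>z t. t ^ m * h (pt z t)"]
        cont_int[OF h(1), of m] by (simp add: split_beta)
    fix i assume i: "i < n"
    let ?h' = "partial_deriv i h"
    have h': "smooth_on_Euclidean n Q ?h'"
      using smooth_on_Euclidean_partial_deriv[OF h(1) i] .
    have "has_partial g i z (integral {0..1} (\<lambda>t. t ^ Suc m * ?h' (pt z t)))" if z: "z \<in> Q" for z
    proof -
      define U where "U = {c i - d<..<c i + d}"
      have upd: "z(i := s) \<in> Q" if "s \<in> U" for s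
        using z that i fun_upd_in_topspace_Euclidean_space[of z n i s]
        by (auto simp: Q_def cube_def U_def)
      have zi: "z i \<in> U"
        using z i by (force simp: Q_def cube_def U_def abs_less_iff)
      have L: "((\<lambda>s. integral (cbox 0 1) (\<lambda>t. t ^ m * h (pt (z(i := s)) t))) has_field_derivative
          integral (cbox 0 1) (\<lambda>t. t ^ Suc m * ?h' (pt (z(i := z i)) t))) (at (z i) within U)"
      proof (rule leibniz_rule_field_derivative[where fx = "\<lambda>s t. t ^ Suc m * ?h' (pt (z(i := s)) t)"])
        fix s t assume s: "s \<in> U" and "t \<in> cbox (0::real) 1"
        then have t: "t \<in> {0..1}" by simp
        \<comment> \<open>moving coordinate \<open>i\<close> of \<open>z\<close> moves coordinate \<open>i\<close> of \<open>w\<close> at speed \<open>t\<close>\<close>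
        define w where "w = pt (z(i := s)) t"
        have w: "w \<in> Q" "w i = c i + t * (s - c i)"
          using pt_Q[OF upd[OF s] t] by (auto simp: w_def pt_def)
        have "pt (z(i := u)) t = w(i := c i + t * (u - c i))" for u
          by (auto simp: w_def pt_def fun_eq_iff)
        moreover have "((\<lambda>u. h (w(i := c i + t * (u - c i)))) has_real_derivative ?h' w * t) (at s)"
        proof (rule DERIV_chain2[where f = "\<lambda>v. h (w(i := v))"])
          show "((\<lambda>v. h (w(i := v))) has_real_derivative ?h' w) (at (c i + t * (s - c i)))"
            using smooth_on_Euclidean_has_partial[OF h(1) i w(1)] unfolding w(2) .
        qed (auto intro!: derivative_eq_intros)
        ultimately have "((\<lambda>u. h (pt (z(i := u)) t)) has_real_derivative ?h' w * t) (at s within U)"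
          by (simp add: has_field_derivative_at_within)
        from DERIV_cmult[OF this, of "t ^ m"]
        show "((\<lambda>u. t ^ m * h (pt (z(i := u)) t)) has_field_derivative
            t ^ Suc m * ?h' (pt (z(i := s)) t)) (at s within U)"
          unfolding w_def[symmetric] by (simp add: mult_ac)
      next
        fix s assume s: "s \<in> U"
        have "continuous_on {0..1} (\<lambda>t. t ^ m * h (pt (z(i := s)) t))"
          using continuous_on_compose2[OF cont_int[OF h(1), of m]
              continuous_on_Pair[OF continuous_on_const[of "{0..1}" "z(i := s)"] continuous_on_id]]
            upd[OF s]
          by (simp add: image_subset_iff)
        then show "(\<lambda>t. t ^ m * h (pt (z(i := s)) t)) integrable_on cbox 0 1"
          by (simp add: integrable_continuous_interval)
      next
        have "continuous_on (U \<times> {0..1}) (\<lambda>x. z(i := fst x))"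
        proof (rule continuous_on_coordinatewise_then_product)
          show "continuous_on (U \<times> {0..1}) (\<lambda>x. (z(i := fst x)) j)" for j
            by (cases "j = i") (auto intro!: continuous_intros)
        qed
        then have "continuous_on (U \<times> {0..1}) (\<lambda>x. (z(i := fst x), snd x))"
          by (rule continuous_on_Pair[OF _ continuous_on_snd[OF continuous_on_id]])
        then show "continuous_on (U \<times> cbox 0 1) (\<lambda>(s, t). t ^ Suc m * ?h' (pt (z(i := s)) t))"
          using continuous_on_compose2[OF cont_int[OF h', of "Suc m"],
              of "U \<times> {0..1}" "\<lambda>x. (z(i := fst x), snd x)"] upd
          by (simp add: split_beta image_subset_iff)
      qed (use zi in \<open>auto simp: U_def\<close>)
      have "at (z i) within U = at (z i)"
        by (rule at_within_open[OF zi]) (simp only: U_def open_greaterThanLessThan)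
      from L[unfolded this fun_upd_triv cbox_interval] show ?thesis
        unfolding h(2) .
    qed
    moreover have "(\<lambda>z. integral {0..1} (\<lambda>t. t ^ Suc m * ?h' (pt z t))) \<in> F"
      unfolding F_def using h' by blast
    ultimately show "\<exists>g'\<in>F. \<forall>z\<in>Q. has_partial g i z (g' z)"
      by (intro bexI[of _ "\<lambda>z. integral {0..1} (\<lambda>t. t ^ Suc m * ?h' (pt z t))"] ballI)
  qed
  then show ?thesis
    by (simp add: pt_def Q_def)
qed

text \<open>
  Hadamard's lemma: \<open>f z - f c\<close> is the integral over \<open>0 \<le> t \<le> 1\<close> of the derivative of
  \<open>f (c + t (z - c))\<close>, and the chain rule splits off the factors \<open>z i - c i\<close>.
\<close>
lemma smooth_on_Euclidean_Hadamard:
  assumes c: "c \<in> topspace (Euclidean_space n)" and d: "0 < d" and f: "smooth_on_Euclidean n (cube n c d) f"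
  obtains g where "\<And>i. i < n \<Longrightarrow> smooth_on_Euclidean n (cube n c d) (g i)"
    and "\<And>z. z \<in> cube n c d \<Longrightarrow> f z = f c + (\<Sum>i<n. (z i - c i) * g i z)"
    and "\<And>i. i < n \<Longrightarrow> g i c = partial_deriv i f c"
proof
  define g where "g = (\<lambda>i z. integral {0..1} (\<lambda>t. t ^ 0 * partial_deriv i f (\<lambda>j. c j + t * (z j - c j))))"
  show "smooth_on_Euclidean n (cube n c d) (g i)" if "i < n" for i
    unfolding g_def
    by (rule smooth_on_Euclidean_radial_integral[OF c d smooth_on_Euclidean_partial_deriv[OF f that]])
  show "g i c = partial_deriv i f c" if "i < n" for i
    by (simp add: g_def)
  show "f z = f c + (\<Sum>i<n. (z i - c i) * g i z)" if z: "z \<in> cube n c d" for z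
  proof -
    define pt where "pt = (\<lambda>t j. c j + t * (z j - c j))"
    have pt_E: "pt t \<in> topspace (Euclidean_space n)" for t
      using c z by (auto simp: pt_def cube_def topspace_Euclidean_space)
    have pt_Q: "pt t \<in> cube n c d" if "t \<in> {0..1}" for t
    proof -
      have "\<bar>t * (z j - c j)\<bar> \<le> \<bar>z j - c j\<bar>" for j
        using that by (simp add: abs_mult mult_left_le_one_le)
      then show ?thesis
        using z pt_E[of t] by (auto simp: cube_def pt_def intro: le_less_trans)
    qed
    have cont: "continuous_on {0..1} (\<lambda>t. partial_deriv i f (pt t))" if "i < n" for i
    proof (rule continuous_on_compose2[where g = "partial_deriv i f" and f = pt])
      show "continuous_on (cube n c d) (partial_deriv i f)"
        by (rule smooth_on_Euclidean_continuous_on[OF smooth_on_Euclidean_partial_deriv[OF f that]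
              openin_Euclidean_subset[OF openin_cube]])
      show "continuous_on {0..1} pt"
        unfolding pt_def by (intro continuous_on_coordinatewise_then_product continuous_intros)
    qed (use pt_Q in auto)
    have "((\<lambda>t. \<Sum>i<n. partial_deriv i f (pt t) * (z i - c i)) has_integral f (pt 1) - f (pt 0)) {0..1}"
    proof (rule fundamental_theorem_of_calculus[where f = "\<lambda>t. f (pt t)"])
      fix t :: real assume t: "t \<in> {0..1}"
      have "((\<lambda>t. f (pt t)) has_real_derivative (\<Sum>i<n. partial_deriv i f (pt t) * (z i - c i))) (at t)"
        by (rule smooth_on_Euclidean_curve[OF openin_cube f, where \<gamma> = pt, OF pt_Q[OF t]],
            simp add: pt_E, auto simp: pt_def intro!: derivative_eq_intros)
      then show "((\<lambda>t. f (pt t)) has_vector_derivative (\<Sum>i<n. partial_deriv i f (pt t) * (z i - c i)))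
          (at t within {0..1})"
        by (simp add: has_field_derivative_at_within flip: has_real_derivative_iff_has_vector_derivative)
    qed simp
    moreover have "((\<lambda>t. \<Sum>i<n. partial_deriv i f (pt t) * (z i - c i)) has_integral
        (\<Sum>i<n. integral {0..1} (\<lambda>t. partial_deriv i f (pt t)) * (z i - c i))) {0..1}"
      using cont
      by (intro has_integral_sum has_integral_mult_left integrable_integral integrable_continuous_interval) auto
    ultimately have "f (pt 1) - f (pt 0) = (\<Sum>i<n. integral {0..1} (\<lambda>t. partial_deriv i f (pt t)) * (z i - c i))"
      by (rule has_integral_unique)
    then show ?thesis
      by (simp add: pt_def g_def mult.commute)
  qed
qed

section \<open>Smooth functions on a manifold\<close>

lemma openin_subtopology_Euclidean_trans:
  assumes "openin (subtopology (Euclidean_space n) S) T" "openin (Euclidean_space n) S"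
  shows "openin (Euclidean_space n) T"
  using assms openin_trans_full by blast

locale smooth_atlas =
  fixes n :: nat and A :: "('m::{t2_space,second_countable_topology}) chart set"
  assumes smooth_manifold: "smooth_manifold n A"
begin

lemma chart_is_chart: "(U, x) \<in> A \<Longrightarrow> is_chart n (U, x)"
  using conjunct1[OF smooth_manifold[unfolded smooth_manifold_def]] by (rule bspec)

lemma chart_open: "(U, x) \<in> A \<Longrightarrow> open U"
  using chart_is_chart by (auto simp: is_chart_def)

lemma chart_homeomorphic:
  "(U, x) \<in> A \<Longrightarrow> homeomorphic_map (top_of_set U) (subtopology (Euclidean_space n) (x ` U)) x"
  using chart_is_chart by (auto simp: is_chart_def)

lemma chart_inj_on: "(U, x) \<in> A \<Longrightarrow> inj_on x U"
  using homeomorphic_imp_injective_map[OF chart_homeomorphic] by simp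

lemma chart_inv_into: "(U, x) \<in> A \<Longrightarrow> q \<in> U \<Longrightarrow> inv_into U x (x q) = q"
  by (simp add: chart_inj_on)

lemma chart_range_openin: "(U, x) \<in> A \<Longrightarrow> openin (Euclidean_space n) (x ` U)"
  using chart_is_chart by (auto simp: is_chart_def)

lemma chart_image_openin:
  assumes "(U, x) \<in> A" "open W"
  shows "openin (Euclidean_space n) (x ` (U \<inter> W))"
proof -
  have "openin (subtopology (Euclidean_space n) (x ` U)) (x ` (U \<inter> W))"
    using homeomorphic_imp_open_map[OF chart_homeomorphic[OF assms(1)]] openin_open_Int[OF assms(2)]
    by (auto simp: open_map_def)
  then show ?thesis
    using chart_range_openin[OF assms(1)] by (rule openin_subtopology_Euclidean_trans)
qed

lemma chart_preimage_open:
  assumes c: "(U, x) \<in> A" and Q: "openin (Euclidean_space n) Q"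
  shows "open {q \<in> U. x q \<in> Q}"
proof -
  have "openin (subtopology (Euclidean_space n) (x ` U)) (x ` U \<inter> Q)"
    using Q by (metis inf_commute openin_subtopology_Int)
  then have "openin (top_of_set U) {q \<in> topspace (top_of_set U). x q \<in> x ` U \<inter> Q}"
    by (rule openin_continuous_map_preimage[OF homeomorphic_imp_continuous_map[OF chart_homeomorphic[OF c]]])
  moreover have "{q \<in> topspace (top_of_set U). x q \<in> x ` U \<inter> Q} = {q \<in> U. x q \<in> Q}"
    by auto
  ultimately show ?thesis
    using openin_open_trans[OF _ chart_open[OF c]] by simp
qed

lemma chart_in_topspace: "(U, x) \<in> A \<Longrightarrow> q \<in> U \<Longrightarrow> x q \<in> topspace (Euclidean_space n)"
  using openin_Euclidean_subset[OF chart_range_openin] by blast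

lemma smooth_functionsI:
  assumes "\<And>U x. (U, x) \<in> A \<Longrightarrow> smooth_on_Euclidean n (x ` (U \<inter> V)) (\<lambda>z. f (inv_into U x z))"
  shows "f \<in> smooth_functions n A V"
  using assms by (auto simp: smooth_functions_def)

lemma smooth_functionsD:
  assumes "f \<in> smooth_functions n A V" "(U, x) \<in> A"
  shows "smooth_on_Euclidean n (x ` (U \<inter> V)) (\<lambda>z. f (inv_into U x z))"
  using assms by (auto simp: smooth_functions_def)

lemma smooth_functions_subset:
  assumes "f \<in> smooth_functions n A V" "W \<subseteq> V"
  shows "f \<in> smooth_functions n A W"
proof (rule smooth_functionsI)
  fix U x assume "(U, x) \<in> A"
  then show "smooth_on_Euclidean n (x ` (U \<inter> W)) (\<lambda>z. f (inv_into U x z))"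
    using assms by (intro smooth_on_Euclidean_subset[OF smooth_functionsD[OF assms(1)]]) auto
qed

lemma smooth_functions_cong:
  assumes V: "open V" and f: "f \<in> smooth_functions n A V" and eq: "\<And>q. q \<in> V \<Longrightarrow> g q = f q"
  shows "g \<in> smooth_functions n A V"
proof (rule smooth_functionsI)
  fix U x assume c: "(U, x) \<in> A"
  show "smooth_on_Euclidean n (x ` (U \<inter> V)) (\<lambda>z. g (inv_into U x z))"
    by (rule smooth_on_Euclidean_cong[OF chart_image_openin[OF c V] smooth_functionsD[OF f c]])
      (auto simp: chart_inv_into[OF c] eq)
qed

text \<open>
  Smooth functions form a sheaf; this is what makes it possible to define functions and fields by
  different formulas inside and outside a chart.
\<close>
lemma smooth_functions_locally:
  assumes V: "open V"
    and loc: "\<And>q. q \<in> V \<Longrightarrow> \<exists>W. open W \<and> q \<in> W \<and> f \<in> smooth_functions n A W"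
  shows "f \<in> smooth_functions n A V"
proof (rule smooth_functionsI)
  fix U x assume c: "(U, x) \<in> A"
  show "smooth_on_Euclidean n (x ` (U \<inter> V)) (\<lambda>z. f (inv_into U x z))"
  proof (rule smooth_on_Euclidean_locally[OF chart_image_openin[OF c V]])
    fix z assume "z \<in> x ` (U \<inter> V)"
    then obtain q where q: "q \<in> U" "q \<in> V" "z = x q" by blast
    obtain W where "open W" "q \<in> W" "f \<in> smooth_functions n A W"
      using loc[OF q(2)] by blast
    then show "\<exists>T. openin (Euclidean_space n) T \<and> z \<in> T \<and> smooth_on_Euclidean n T (\<lambda>z. f (inv_into U x z))"
      using chart_image_openin[OF c, of W] smooth_functionsD[OF _ c, of f W] q by blast
  qed
qed

lemma smooth_functions_const: "open V \<Longrightarrow> (\<lambda>q. c) \<in> smooth_functions n A V"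
  by (intro smooth_functionsI smooth_on_Euclidean_const chart_image_openin)

lemma smooth_functions_add:
  assumes "open V" "f \<in> smooth_functions n A V" "g \<in> smooth_functions n A V"
  shows "(\<lambda>q. f q + g q) \<in> smooth_functions n A V"
  by (rule smooth_functionsI, rule smooth_on_Euclidean_add[OF chart_image_openin])
    (use assms smooth_functionsD in blast)+

lemma smooth_functions_mult:
  assumes "open V" "f \<in> smooth_functions n A V" "g \<in> smooth_functions n A V"
  shows "(\<lambda>q. f q * g q) \<in> smooth_functions n A V"
  by (rule smooth_functionsI, rule smooth_on_Euclidean_mult[OF chart_image_openin])
    (use assms smooth_functionsD in blast)+

lemma smooth_functions_chart_coordinate:
  assumes "(U, x) \<in> A" "i < n"
  shows "(\<lambda>q. x q i) \<in> smooth_functions n A U"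
proof (rule smooth_functionsI)
  fix V y assume "(V, y) \<in> A"
  then have "smooth_transition n (V, y) (U, x)"
    using assms(1) conjunct1[OF conjunct2[OF conjunct2[OF smooth_manifold[unfolded smooth_manifold_def]]]]
    by blast
  then show "smooth_on_Euclidean n (y ` (V \<inter> U)) (\<lambda>z. x (inv_into V y z) i)"
    using assms(2) by (simp add: smooth_transition_def)
qed

lemma smooth_functions_compose_chart:
  assumes c: "(U, x) \<in> A" and W: "open W" "W \<subseteq> U"
    and Q: "openin (Euclidean_space n) Q" "x ` W \<subseteq> Q" and G: "smooth_on_Euclidean n Q G"
  shows "(\<lambda>q. G (x q)) \<in> smooth_functions n A W"
proof (rule smooth_functionsI)
  fix V y assume d: "(V, y) \<in> A"
  show "smooth_on_Euclidean n (y ` (V \<inter> W)) (\<lambda>z. G (x (inv_into V y z)))"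
  proof (rule smooth_on_Euclidean_compose[OF chart_image_openin[OF d W(1)] Q(1) G])
    show "smooth_on_Euclidean n (y ` (V \<inter> W)) (\<lambda>z. x (inv_into V y z) j)" if "j < n" for j
      using smooth_functionsD[OF smooth_functions_subset[OF smooth_functions_chart_coordinate[OF c that] W(2)] d] .
    show "x (inv_into V y z) \<in> Q" if "z \<in> y ` (V \<inter> W)" for z
      using that Q(2) by (auto simp: chart_inv_into[OF d])
  qed
qed

lemma smooth_nearI: "open V \<Longrightarrow> p \<in> V \<Longrightarrow> f \<in> smooth_functions n A V \<Longrightarrow> smooth_near n A p f"
  by (auto simp: smooth_near_def)

lemma smooth_near_common:
  assumes "smooth_near n A p f" "smooth_near n A p g"
  obtains V where "open V" "p \<in> V" "f \<in> smooth_functions n A V" "g \<in> smooth_functions n A V"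
proof -
  obtain V W where "open V" "p \<in> V" "f \<in> smooth_functions n A V"
      "open W" "p \<in> W" "g \<in> smooth_functions n A W"
    using assms by (auto simp: smooth_near_def)
  then show thesis
    using that[of "V \<inter> W"] smooth_functions_subset by auto
qed

lemma smooth_near_const: "smooth_near n A p (\<lambda>q. c)"
  using smooth_functions_const[OF open_UNIV] by (rule smooth_nearI[OF open_UNIV UNIV_I])

lemma smooth_near_add:
  assumes "smooth_near n A p f" "smooth_near n A p g"
  shows "smooth_near n A p (\<lambda>q. f q + g q)"
  by (rule smooth_near_common[OF assms]) (blast intro: smooth_nearI smooth_functions_add)

lemma smooth_near_mult:
  assumes "smooth_near n A p f" "smooth_near n A p g"
  shows "smooth_near n A p (\<lambda>q. f q * g q)"
  by (rule smooth_near_common[OF assms]) (blast intro: smooth_nearI smooth_functions_mult)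

lemma smooth_near_sum:
  "finite J \<Longrightarrow> (\<And>j. j \<in> J \<Longrightarrow> smooth_near n A p (f j)) \<Longrightarrow> smooth_near n A p (\<lambda>q. \<Sum>j\<in>J. f j q)"
  by (induction J rule: finite_induct) (auto intro: smooth_near_const smooth_near_add)

lemma smooth_near_prod:
  "finite J \<Longrightarrow> (\<And>j. j \<in> J \<Longrightarrow> smooth_near n A p (f j)) \<Longrightarrow> smooth_near n A p (\<lambda>q. \<Prod>j\<in>J. f j q)"
  by (induction J rule: finite_induct) (auto intro: smooth_near_const smooth_near_mult)

lemma smooth_near_cong:
  assumes "smooth_near n A p f" "\<forall>\<^sub>F q in nhds p. g q = f q"
  shows "smooth_near n A p g"
proof -
  obtain V W where VW: "open V" "p \<in> V" "f \<in> smooth_functions n A V"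
      "open W" "p \<in> W" "\<And>q. q \<in> W \<Longrightarrow> g q = f q"
    using assms by (auto simp: smooth_near_def eventually_nhds)
  have "f \<in> smooth_functions n A (V \<inter> W)"
    using VW by (auto intro: smooth_functions_subset)
  then have "g \<in> smooth_functions n A (V \<inter> W)"
    using VW by (intro smooth_functions_cong[of "V \<inter> W" f g]) auto
  then show ?thesis
    using VW by (intro smooth_nearI[of "V \<inter> W"]) auto
qed

section \<open>Tangent vectors and vector fields\<close>

lemma tangent_linear:
  assumes "v \<in> tangent_space n A p" "smooth_near n A p f" "smooth_near n A p g"
  shows "v (\<lambda>q. c * f q + d * g q) = c * v f + d * v g"
  using assms by (simp add: tangent_space_def)

lemma tangent_add:
  assumes "v \<in> tangent_space n A p" "smooth_near n A p f" "smooth_near n A p g"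
  shows "v (\<lambda>q. f q + g q) = v f + v g"
  using tangent_linear[OF assms, of 1 1] by simp

lemma tangent_mult:
  assumes "v \<in> tangent_space n A p" "smooth_near n A p f" "smooth_near n A p g"
  shows "v (\<lambda>q. f q * g q) = f p * v g + g p * v f"
  using assms by (simp add: tangent_space_def)

lemma tangent_const:
  assumes "v \<in> tangent_space n A p"
  shows "v (\<lambda>q. c) = 0"
proof -
  have "v (\<lambda>q. 1) = 0"
    using tangent_mult[OF assms smooth_near_const[of p 1] smooth_near_const[of p 1]] by simp
  then show ?thesis
    using tangent_linear[OF assms smooth_near_const[of p 1] smooth_near_const[of p 1], of c 0] by simp
qed

text \<open>
  A derivation sees only the germ of its argument.  The difference \<open>h\<close> of two functions with the same
  germ equals \<open>h * off\<close>, where \<open>off\<close> vanishes near \<open>p\<close> and is 1 elsewhere; the Leibniz rule at \<open>p\<close>,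
  where both factors vanish, gives \<open>v h = 0\<close>.  It applies to \<open>off\<close>, discontinuous as it may be,
  since \<open>off\<close> is constant near \<open>p\<close>.
\<close>
lemma tangent_cong:
  assumes v: "v \<in> tangent_space n A p" and f: "smooth_near n A p f"
    and eq: "\<forall>\<^sub>F q in nhds p. g q = f q"
  shows "v g = v f"
proof -
  have g: "smooth_near n A p g"
    using smooth_near_cong[OF f eq] .
  obtain W where W: "open W" "p \<in> W" "\<And>q. q \<in> W \<Longrightarrow> g q = f q"
    using eq by (auto simp: eventually_nhds)
  define h where "h = (\<lambda>q. 1 * g q + (-1) * f q)"
  define off :: "'m \<Rightarrow> real" where "off = (\<lambda>q. if q \<in> W then 0 else 1)"
  have vh: "v h = v g - v f"
    unfolding h_def using tangent_linear[OF v g f, of 1 "-1"] by simp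
  have h: "smooth_near n A p h"
    unfolding h_def by (intro smooth_near_add smooth_near_mult smooth_near_const f g)
  have off: "smooth_near n A p off"
    by (rule smooth_near_cong[OF smooth_near_const[of p 0]])
      (use W in \<open>auto simp: off_def eventually_nhds intro!: exI[of _ W]\<close>)
  have "h = (\<lambda>q. h q * off q)"
    using W(3) by (auto simp: h_def off_def fun_eq_iff)
  then have "v h = v (\<lambda>q. h q * off q)" by simp
  also have "\<dots> = 0"
    using tangent_mult[OF v h off] W by (simp add: h_def off_def)
  finally show ?thesis using vh by simp
qed

lemma tangent_sum:
  assumes v: "v \<in> tangent_space n A p" and "finite J" "\<And>j. j \<in> J \<Longrightarrow> smooth_near n A p (f j)"
  shows "v (\<lambda>q. \<Sum>j\<in>J. f j q) = (\<Sum>j\<in>J. v (f j))"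
  using assms(2,3)
proof (induction J rule: finite_induct)
  case empty
  then show ?case by (simp add: tangent_const[OF v])
next
  case (insert j J)
  then show ?case
    using tangent_add[OF v, of "f j" "\<lambda>q. \<Sum>j\<in>J. f j q"] smooth_near_sum[of J p f] by simp
qed

lemma tangent_prod:
  assumes v: "v \<in> tangent_space n A p" and "finite J" "\<And>j. j \<in> J \<Longrightarrow> smooth_near n A p (f j)"
  shows "v (\<lambda>q. \<Prod>j\<in>J. f j q) = (\<Sum>s\<in>J. v (f s) * (\<Prod>j\<in>J - {s}. f j p))"
  using assms(2,3)
proof (induction J rule: finite_induct)
  case empty
  then show ?case by (simp add: tangent_const[OF v])
next
  case (insert i J)
  have eq: "(\<Prod>j\<in>insert i J - {s}. f j p) = f i p * (\<Prod>j\<in>J - {s}. f j p)" if "s \<in> J" for s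
  proof -
    have "insert i J - {s} = insert i (J - {s})" using that insert.hyps by auto
    then show ?thesis using insert.hyps by simp
  qed
  have "v (\<lambda>q. \<Prod>j\<in>insert i J. f j q) = v (\<lambda>q. f i q * (\<Prod>j\<in>J. f j q))"
    using insert.hyps by simp
  also have "\<dots> = f i p * v (\<lambda>q. \<Prod>j\<in>J. f j q) + (\<Prod>j\<in>J. f j p) * v (f i)"
    using insert.hyps insert.prems by (intro tangent_mult[OF v] smooth_near_prod) auto
  also have "v (\<lambda>q. \<Prod>j\<in>J. f j q) = (\<Sum>s\<in>J. v (f s) * (\<Prod>j\<in>J - {s}. f j p))"
    using insert by simp
  also have "f i p * \<dots> = (\<Sum>s\<in>J. v (f s) * (\<Prod>j\<in>insert i J - {s}. f j p))"
    unfolding sum_distrib_left by (intro sum.cong refl) (simp add: eq)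
  also have "\<dots> + (\<Prod>j\<in>J. f j p) * v (f i) = (\<Sum>s\<in>insert i J. v (f s) * (\<Prod>j\<in>insert i J - {s}. f j p))"
    using insert.hyps by (simp add: mult.commute insert_Diff_if)
  finally show ?case .
qed

text \<open>
  Hadamard's lemma in the chart writes \<open>f\<close> near \<open>p\<close> as \<open>f p + (\<Sum>i<n. (x\<^sup>i - x\<^sup>i(p)) g\<^sub>i)\<close>, and a
  derivation at \<open>p\<close> only sees \<open>v(x\<^sup>i) g\<^sub>i(p)\<close> of each product.  This is the step that turns the
  derivatives \<open>X\<^sub>i(a\<^sub>I)\<close> in the coboundary into the partial derivatives in the local formula.
\<close>
lemma tangent_coordinate_expansion:
  assumes c: "(U, x) \<in> A" and p: "p \<in> U" and v: "v \<in> tangent_space n A p" and f: "smooth_near n A p f"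
  shows "v f = (\<Sum>l<n. coord_covector (U, x) l v * coord_deriv (U, x) l f p)"
proof -
  obtain V where V: "open V" "p \<in> V" "f \<in> smooth_functions n A V"
    using f by (auto simp: smooth_near_def)
  define F where "F = (\<lambda>z. f (inv_into U x z))"
  define S where "S = x ` (U \<inter> V)"
  have F: "smooth_on_Euclidean n S F"
    unfolding F_def S_def by (rule smooth_functionsD[OF V(3) c])
  obtain d where d: "0 < d" "cube n (x p) d \<subseteq> S"
    using cube_subset_openin[OF chart_image_openin[OF c V(1)], of "x p"] p V(2)
    unfolding S_def by auto
  have xp: "x p \<in> topspace (Euclidean_space n)"
    by (rule chart_in_topspace[OF c p])
  obtain g where g: "\<And>i. i < n \<Longrightarrow> smooth_on_Euclidean n (cube n (x p) d) (g i)"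
    "\<And>z. z \<in> cube n (x p) d \<Longrightarrow> F z = F (x p) + (\<Sum>i<n. (z i - x p i) * g i z)"
    "\<And>i. i < n \<Longrightarrow> g i (x p) = partial_deriv i F (x p)"
    using smooth_on_Euclidean_Hadamard[OF xp d(1) smooth_on_Euclidean_subset[OF F d(2)]] by blast
  define W where "W = {q \<in> U. x q \<in> cube n (x p) d}"
  have W: "open W" "p \<in> W" "W \<subseteq> U"
    using chart_preimage_open[OF c openin_cube] centre_in_cube[OF xp d(1)] p by (auto simp: W_def)
  have sg: "smooth_near n A p (\<lambda>q. g i (x q))" if "i < n" for i
    by (rule smooth_nearI[OF W(1,2) smooth_functions_compose_chart[OF c W(1,3) openin_cube _ g(1)[OF that]]])
      (auto simp: W_def)
  have sx: "smooth_near n A p (\<lambda>q. x q i)" if "i < n" for i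
    by (rule smooth_nearI[OF chart_open[OF c] p smooth_functions_chart_coordinate[OF c that]])
  have sx': "smooth_near n A p (\<lambda>q. x q i + - x p i)" if "i < n" for i
    by (intro smooth_near_add sx that smooth_near_const)
  define h where "h = (\<lambda>q. f p + (\<Sum>i<n. (x q i + - x p i) * g i (x q)))"
  have eq: "\<forall>\<^sub>F q in nhds p. f q = h q"
    unfolding eventually_nhds
  proof (intro exI conjI ballI)
    fix q assume q: "q \<in> W"
    then show "f q = h q"
      using g(2)[of "x q"] chart_inv_into[OF c] p by (simp add: W_def F_def h_def)
  qed (rule W)+
  have sprod: "smooth_near n A p (\<lambda>q. (x q i + - x p i) * g i (x q))" if "i < n" for i
    by (rule smooth_near_mult[OF sx'[OF that] sg[OF that]])
  have ssum: "smooth_near n A p (\<lambda>q. \<Sum>i<n. (x q i + - x p i) * g i (x q))"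
    by (intro smooth_near_sum sprod) auto
  have sh: "smooth_near n A p h"
    unfolding h_def by (rule smooth_near_add[OF smooth_near_const ssum])
  have "v f = v h" by (rule tangent_cong[OF v sh eq])
  also have "\<dots> = v (\<lambda>q. f p) + v (\<lambda>q. \<Sum>i<n. (x q i + - x p i) * g i (x q))"
    unfolding h_def by (rule tangent_add[OF v smooth_near_const ssum])
  also have "\<dots> = (\<Sum>i<n. v (\<lambda>q. (x q i + - x p i) * g i (x q)))"
    using tangent_sum[OF v _ sprod, of "{..<n}" "\<lambda>i. i"] by (simp add: tangent_const[OF v])
  also have "\<dots> = (\<Sum>i<n. coord_covector (U, x) i v * coord_deriv (U, x) i f p)"
  proof (rule sum.cong[OF refl])
    fix i assume "i \<in> {..<n}"
    then have i: "i < n" by simp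
    have "v (\<lambda>q. (x q i + - x p i) * g i (x q)) = g i (x p) * v (\<lambda>q. x q i + - x p i)"
      using tangent_mult[OF v sx'[OF i] sg[OF i]] by simp
    also have "v (\<lambda>q. x q i + - x p i) = v (\<lambda>q. x q i)"
      using tangent_add[OF v sx[OF i] smooth_near_const[of p "- x p i"]] tangent_const[OF v, of "- x p i"]
      by simp
    finally show "v (\<lambda>q. (x q i + - x p i) * g i (x q)) = coord_covector (U, x) i v * coord_deriv (U, x) i f p"
      by (simp add: g(3)[OF i] coord_covector_def coord_deriv_def F_def)
  qed
  finally show ?thesis .
qed

lemma vector_field_tangent: "X \<in> vector_fields n A U \<Longrightarrow> p \<in> U \<Longrightarrow> X p \<in> tangent_space n A p"
  by (simp add: vector_fields_def)

lemma vector_field_smooth: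
  "X \<in> vector_fields n A U \<Longrightarrow> open V \<Longrightarrow> V \<subseteq> U \<Longrightarrow> f \<in> smooth_functions n A V \<Longrightarrow>
    (\<lambda>p. X p f) \<in> smooth_functions n A V"
  by (simp add: vector_fields_def)

lemma vector_field_smooth_near:
  assumes "X \<in> vector_fields n A U" "open U" "p \<in> U" "smooth_near n A p f"
  shows "smooth_near n A p (\<lambda>q. X q f)"
proof -
  obtain V where V: "open V" "p \<in> V" "f \<in> smooth_functions n A V"
    using assms(4) by (auto simp: smooth_near_def)
  have "(\<lambda>q. X q f) \<in> smooth_functions n A (V \<inter> U)"
    using assms V smooth_functions_subset[OF V(3)] by (intro vector_field_smooth[OF assms(1)]) auto
  then show ?thesis
    using V assms by (intro smooth_nearI[of "V \<inter> U"]) auto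
qed

lemma vector_field_subset:
  "X \<in> vector_fields n A V \<Longrightarrow> U \<subseteq> V \<Longrightarrow> X \<in> vector_fields n A U"
  by (auto simp: vector_fields_def)

lemma eventually_smooth_near:
  assumes "smooth_near n A p f"
  shows "\<forall>\<^sub>F q in nhds p. smooth_near n A q f"
  using assms by (auto simp: smooth_near_def eventually_nhds)

lemma lie_bracket_apply:
  "smooth_near n A p f \<Longrightarrow> lie_bracket n A X Y p f = X p (\<lambda>q. Y q f) - Y p (\<lambda>q. X q f)"
  by (simp add: lie_bracket_def on_germs_def)

lemma iterated_derivation_linear:
  assumes U: "open U" "p \<in> U" and XY: "X \<in> vector_fields n A U" "Y \<in> vector_fields n A U"
    and f: "smooth_near n A p f" and g: "smooth_near n A p g"
  shows "X p (\<lambda>q. Y q (\<lambda>r. c * f r + d * g r)) = c * X p (\<lambda>q. Y q f) + d * X p (\<lambda>q. Y q g)"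
proof -
  have Yf: "smooth_near n A p (\<lambda>q. Y q f)" and Yg: "smooth_near n A p (\<lambda>q. Y q g)"
    using vector_field_smooth_near[OF XY(2) U] f g by auto
  have "\<forall>\<^sub>F q in nhds p. Y q (\<lambda>r. c * f r + d * g r) = c * Y q f + d * Y q g"
    using eventually_smooth_near[OF f] eventually_smooth_near[OF g] eventually_nhds_in_open[OF U]
    by eventually_elim (rule tangent_linear[OF vector_field_tangent[OF XY(2)]])
  then have "X p (\<lambda>q. Y q (\<lambda>r. c * f r + d * g r)) = X p (\<lambda>q. c * Y q f + d * Y q g)"
    by (rule tangent_cong[OF vector_field_tangent[OF XY(1) U(2)], rotated])
      (intro smooth_near_add smooth_near_mult smooth_near_const Yf Yg)
  then show ?thesis
    by (simp add: tangent_linear[OF vector_field_tangent[OF XY(1) U(2)] Yf Yg])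
qed

text \<open>
  The products of two first derivatives are together symmetric in \<open>X\<close> and \<open>Y\<close>, so they drop out of
  the commutator, which is why the bracket of two fields is again a derivation.
\<close>
lemma iterated_derivation_mult:
  assumes U: "open U" "p \<in> U" and XY: "X \<in> vector_fields n A U" "Y \<in> vector_fields n A U"
    and f: "smooth_near n A p f" and g: "smooth_near n A p g"
  shows "X p (\<lambda>q. Y q (\<lambda>r. f r * g r)) =
    f p * X p (\<lambda>q. Y q g) + Y p g * X p f + g p * X p (\<lambda>q. Y q f) + Y p f * X p g"
proof -
  have Xp: "X p \<in> tangent_space n A p" by (rule vector_field_tangent[OF XY(1) U(2)])
  have Yf: "smooth_near n A p (\<lambda>q. Y q f)" and Yg: "smooth_near n A p (\<lambda>q. Y q g)"
    using vector_field_smooth_near[OF XY(2) U] f g by auto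
  have "\<forall>\<^sub>F q in nhds p. Y q (\<lambda>r. f r * g r) = f q * Y q g + g q * Y q f"
    using eventually_smooth_near[OF f] eventually_smooth_near[OF g] eventually_nhds_in_open[OF U]
    by eventually_elim (rule tangent_mult[OF vector_field_tangent[OF XY(2)]])
  then have "X p (\<lambda>q. Y q (\<lambda>r. f r * g r)) = X p (\<lambda>q. f q * Y q g + g q * Y q f)"
    by (rule tangent_cong[OF Xp, rotated]) (intro smooth_near_add smooth_near_mult Yf Yg f g)
  then show ?thesis
    by (simp add: tangent_add[OF Xp smooth_near_mult[OF f Yg] smooth_near_mult[OF g Yf]]
        tangent_mult[OF Xp f Yg] tangent_mult[OF Xp g Yf])
qed

text \<open>
  The bracket has to be a tangent vector before the coordinate expression of \<open>\<omega>\<close> may be evaluated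
  on it.
\<close>
lemma lie_bracket_tangent:
  assumes U: "open U" "p \<in> U" and XY: "X \<in> vector_fields n A U" "Y \<in> vector_fields n A U"
  shows "lie_bracket n A X Y p \<in> tangent_space n A p"
  unfolding tangent_space_def
proof (intro CollectI conjI allI impI)
  fix f g c d assume "smooth_near n A p f \<and> smooth_near n A p g"
  then have f: "smooth_near n A p f" and g: "smooth_near n A p g" by auto
  have lin: "smooth_near n A p (\<lambda>q. c * f q + d * g q)"
    by (intro smooth_near_add smooth_near_mult smooth_near_const f g)
  show "lie_bracket n A X Y p (\<lambda>q. c * f q + d * g q) =
      c * lie_bracket n A X Y p f + d * lie_bracket n A X Y p g"
    by (simp add: lie_bracket_apply lin f g iterated_derivation_linear[OF U XY f g]
        iterated_derivation_linear[OF U XY(2,1) f g] algebra_simps)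
  show "lie_bracket n A X Y p (\<lambda>q. f q * g q) =
      f p * lie_bracket n A X Y p g + g p * lie_bracket n A X Y p f"
    by (simp add: lie_bracket_apply smooth_near_mult f g iterated_derivation_mult[OF U XY f g]
        iterated_derivation_mult[OF U XY(2,1) f g] algebra_simps)
next
  fix f assume "\<not> smooth_near n A p f"
  then show "lie_bracket n A X Y p f = 0"
    by (simp add: lie_bracket_def on_germs_def)
qed

section \<open>Extending vector fields from a chart to the manifold\<close>

text \<open>
  A closed box contained in the chart range is compact, so its preimage is compact, hence closed in
  the whole Hausdorff space and not only in the chart domain.
\<close>
lemma closed_coordinate_box:
  assumes c: "(U, x) \<in> A" and p: "p \<in> U" and d: "cube n (x p) d \<subseteq> x ` U" and e: "e < d"
  shows "closed {q \<in> U. \<forall>i<n. \<bar>x q i - x p i\<bar> \<le> e}"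
proof -
  define C where "C = (\<Pi>\<^sub>E i\<in>UNIV. if i < n then {x p i - e..x p i + e} else {0})"
  have C: "w \<in> C \<longleftrightarrow> w \<in> topspace (Euclidean_space n) \<and> (\<forall>i<n. \<bar>w i - x p i\<bar> \<le> e)" for w
  proof -
    have "w i \<in> (if i < n then {x p i - e..x p i + e} else {0}) \<longleftrightarrow>
        (if i < n then \<bar>w i - x p i\<bar> \<le> e else w i = 0)" for i
      by auto
    then show ?thesis
      unfolding C_def PiE_UNIV_domain Pi_iff by (auto simp: topspace_Euclidean_space not_less split: if_splits)
  qed
  have "compactin (product_topology (\<lambda>i. euclideanreal) UNIV) C"
    unfolding C_def by (subst compactin_PiE) auto
  then have "compact C"
    by (simp add: euclidean_product_topology)
  have CU: "C \<subseteq> x ` U"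
  proof
    fix w assume "w \<in> C"
    then have "w \<in> cube n (x p) d"
      using e by (auto simp: C cube_def intro: le_less_trans)
    then show "w \<in> x ` U" using d by blast
  qed
  obtain g where g: "continuous_map (subtopology (Euclidean_space n) (x ` U)) (top_of_set U) g"
      "\<And>q. q \<in> U \<Longrightarrow> g (x q) = q"
    using chart_homeomorphic[OF c] unfolding homeomorphic_map_maps homeomorphic_maps_def by auto
  have xU: "x ` U \<subseteq> topspace (Euclidean_space n)"
    by (rule openin_Euclidean_subset[OF chart_range_openin[OF c]])
  have "continuous_on (x ` U) g"
    using g(1) unfolding subtopology_Euclidean_space[OF xU] continuous_map_in_subtopology
    by (simp only: continuous_map_iff_continuous)
  then have "compact (g ` C)"
    by (rule compact_continuous_image[OF continuous_on_subset[OF _ CU] \<open>compact C\<close>])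
  moreover have "g ` C = {q \<in> U. \<forall>i<n. \<bar>x q i - x p i\<bar> \<le> e}"
  proof (intro equalityI subsetI)
    fix q assume "q \<in> g ` C"
    then obtain w where w: "w \<in> C" "q = g w" by blast
    moreover obtain r where "r \<in> U" "w = x r" using CU w(1) by blast
    ultimately show "q \<in> {q \<in> U. \<forall>i<n. \<bar>x q i - x p i\<bar> \<le> e}"
      using g(2) by (simp add: C)
  next
    fix q assume "q \<in> {q \<in> U. \<forall>i<n. \<bar>x q i - x p i\<bar> \<le> e}"
    then have "x q \<in> C" "g (x q) = q"
      using g(2) xU by (auto simp: C)
    then show "q \<in> g ` C" by force
  qed
  ultimately show ?thesis
    by (metis compact_imp_closed)
qed

text \<open>
  Multiplication by a bump function that is 1 near \<open>p\<close> and vanishes off the closed set \<open>K \<subseteq> U\<close> gives a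
  field that is smooth on \<open>U\<close> and zero on the open set \<open>- K\<close>, and these two sets cover the manifold.
\<close>
lemma vector_field_extension:
  assumes c: "(U, x) \<in> A" and p: "p \<in> U" and X: "X \<in> vector_fields n A U"
  obtains Y where "Y \<in> vector_fields n A UNIV" "\<forall>\<^sub>F q in nhds p. Y q = X q"
proof -
  have U: "open U" by (rule chart_open[OF c])
  obtain d where d: "0 < d" "cube n (x p) d \<subseteq> x ` U"
    using cube_subset_openin[OF chart_range_openin[OF c] imageI[OF p]] by blast
  \<comment> \<open>small enough that the closed box of radius \<open>3/2 e\<close>, outside of which the bump function vanishes,
    still lies in the chart range\<close>
  define e where "e = d / 2"
  have e: "0 < e" "3 / 2 * e < d" using d(1) by (auto simp: e_def)
  define K where "K = {q \<in> U. \<forall>i<n. \<bar>x q i - x p i\<bar> \<le> 3 / 2 * e}"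
  have K: "closed K"
    unfolding K_def by (rule closed_coordinate_box[OF c p d(2) e(2)])
  define b where "b = (\<lambda>q. if q \<in> U then bump n (x p) e (x q) else 0)"
  have b_out: "b q = 0" if q: "q \<notin> K" for q
  proof (cases "q \<in> U")
    case True
    then have "\<not> (\<forall>i<n. \<bar>x q i - x p i\<bar> \<le> 3 / 2 * e)"
      using q unfolding K_def by blast
    then obtain i where "i < n" "\<not> \<bar>x q i - x p i\<bar> \<le> 3 / 2 * e"
      by blast
    then show ?thesis
      using bump_eq_0[OF e(1), of i n "x q" "x p"] True by (simp add: b_def)
  qed (simp add: b_def)
  have b_smooth: "b \<in> smooth_functions n A U"
    by (rule smooth_functions_cong[OF U smooth_functions_compose_chart[OF c U order_refl
          chart_range_openin[OF c] order_refl smooth_on_Euclidean_bump[OF chart_range_openin[OF c]]]])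
      (simp add: b_def)
  define Y where "Y = (\<lambda>q f. b q * X q f)"
  have Y_out: "Y q = (\<lambda>f. 0)" if "q \<notin> K" for q
    using b_out[OF that] by (simp add: Y_def)
  have "Y \<in> vector_fields n A UNIV"
    unfolding vector_fields_def
  proof (intro CollectI conjI ballI allI impI)
    fix q
    show "Y q \<in> tangent_space n A q"
    proof (cases "q \<in> U")
      case True
      then show ?thesis
        using vector_field_tangent[OF X True] unfolding tangent_space_def
        by (auto simp: Y_def algebra_simps)
    next
      case False
      then have "Y q = (\<lambda>f. 0)" by (intro Y_out) (simp add: K_def)
      then show ?thesis by (simp add: tangent_space_def)
    qed
  next
    fix V f assume "open V \<and> V \<subseteq> UNIV \<and> f \<in> smooth_functions n A V"
    then have V: "open V" and f: "f \<in> smooth_functions n A V" by auto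
    show "(\<lambda>q. Y q f) \<in> smooth_functions n A V"
    proof (rule smooth_functions_locally[OF V])
      fix q assume q: "q \<in> V"
      show "\<exists>W. open W \<and> q \<in> W \<and> (\<lambda>q. Y q f) \<in> smooth_functions n A W"
      proof (cases "q \<in> U")
        case True
        have "(\<lambda>q. X q f) \<in> smooth_functions n A (V \<inter> U)"
          using V U smooth_functions_subset[OF f] by (intro vector_field_smooth[OF X]) auto
        then have "(\<lambda>q. b q * X q f) \<in> smooth_functions n A (V \<inter> U)"
          using V U smooth_functions_subset[OF b_smooth] by (intro smooth_functions_mult) auto
        then show ?thesis
          using True q V U by (intro exI[of _ "V \<inter> U"]) (auto simp: Y_def)
      next
        case False
        have "open (- K)" using K by (simp add: open_Compl)
        moreover have "(\<lambda>q. Y q f) \<in> smooth_functions n A (- K)"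
          by (rule smooth_functions_cong[OF \<open>open (- K)\<close> smooth_functions_const[OF \<open>open (- K)\<close>, of 0]])
            (simp add: Y_out)
        ultimately show ?thesis
          using False by (intro exI[of _ "- K"]) (auto simp: K_def)
      qed
    qed
  qed
  moreover have "\<forall>\<^sub>F q in nhds p. Y q = X q"
    unfolding eventually_nhds
  proof (intro exI conjI ballI)
    show "open {q \<in> U. x q \<in> cube n (x p) e}"
      by (rule chart_preimage_open[OF c openin_cube])
    show "p \<in> {q \<in> U. x q \<in> cube n (x p) e}"
      using p centre_in_cube[OF chart_in_topspace[OF c p] e(1)] by simp
    show "Y q = X q" if "q \<in> {q \<in> U. x q \<in> cube n (x p) e}" for q
      using that bump_eq_1[OF e(1)] by (simp add: Y_def b_def)
  qed
  ultimately show thesis by (rule that)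
qed

end

section \<open>Cancellation in the Leibniz coboundary\<close>

text \<open>
  The position in the original list of the entry \<open>r\<close> of a list from which entry \<open>i\<close> has been deleted;
  an enumeration of all positions other than \<open>i\<close> (the coface map of simplicial sets).
\<close>
definition skip :: "nat \<Rightarrow> nat \<Rightarrow> nat" where
  "skip i r = (if r < i then r else Suc r)"

lemma delete_nth_nth:
  assumes "i < length xs" "Suc r < length xs"
  shows "delete_nth i xs ! r = xs ! skip i r"
  using assms by (auto simp: delete_nth_def skip_def nth_append)

lemma length_delete_nth: "i < length xs \<Longrightarrow> length (delete_nth i xs) = length xs - 1"
  by (simp add: delete_nth_def)

lemma set_delete_nth_subset: "set (delete_nth i xs) \<subseteq> set xs"
  by (auto simp: delete_nth_def dest: in_set_takeD in_set_dropD)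

lemma prod_skip:
  fixes F :: "nat \<Rightarrow> 'a::comm_monoid_mult"
  assumes "i \<le> k"
  shows "(\<Prod>q<Suc k. F q) = F i * (\<Prod>t<k. F (skip i t))"
proof -
  have "inj_on (skip i) {..<k}"
    by (auto simp: inj_on_def skip_def split: if_splits)
  moreover have "skip i ` {..<k} = {..<Suc k} - {i}"
  proof (intro equalityI subsetI)
    fix q assume q: "q \<in> {..<Suc k} - {i}"
    show "q \<in> skip i ` {..<k}"
    proof (cases "q < i")
      case True
      then show ?thesis using q assms by (intro image_eqI[of _ _ q]) (auto simp: skip_def)
    next
      case False
      then show ?thesis using q by (intro image_eqI[of _ _ "q - 1"]) (auto simp: skip_def)
    qed
  qed (auto simp: skip_def)
  ultimately have "(\<Prod>t<k. F (skip i t)) = (\<Prod>q\<in>{..<Suc k} - {i}. F q)"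
    by (metis prod.reindex_cong)
  then show ?thesis
    using assms by (simp add: prod.remove[of "{..<Suc k}" i] del: prod.lessThan_Suc)
qed

lemma prod_skip_remove:
  fixes F :: "nat \<Rightarrow> 'a::comm_monoid_mult"
  assumes "i \<le> k" "s < k"
  shows "(\<Prod>q<Suc k. F q) = F i * (F (skip i s) * (\<Prod>t\<in>{..<k} - {s}. F (skip i t)))"
  using prod_skip[OF assms(1), of F] prod.remove[of "{..<k}" s "\<lambda>t. F (skip i t)"] assms(2) by simp

text \<open>
  For a single basis tensor with constant coefficient, \<open>h i j s\<close> stands for the derivative along the
  field \<open>i\<close> of the component of the field \<open>j\<close> in slot \<open>s\<close>, and \<open>Q i s\<close> for the product of the
  undifferentiated factors when the field \<open>i\<close> is omitted and slot \<open>s\<close> is left out.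

  The first sum comes from the derivatives of functions, the second from the brackets.  The terms in
  which a field differentiates an earlier one (\<open>s < i\<close>) cancel against the second halves
  of the brackets.  What remains are two families of terms in which the field \<open>r\<close> differentiates a later field
  \<open>j\<close>; for \<open>j = Suc r\<close> they agree up to sign, by the hypothesis on \<open>Q\<close>, and cancel as well.  The
  survivors, with \<open>j \<ge> r + 2\<close>, are the two sums in the definition of \<open>S\<close>.
\<close>
lemma leibniz_cancellation:
  fixes h :: "nat \<Rightarrow> nat \<Rightarrow> nat \<Rightarrow> real" and Q :: "nat \<Rightarrow> nat \<Rightarrow> real"
  assumes Q: "\<And>i. i < k \<Longrightarrow> Q (Suc i) i = Q i i"
  shows "(\<Sum>i<Suc k. (-1) ^ i * (\<Sum>s<k. h i (skip i s) s * Q i s)) +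
      (\<Sum>j<Suc k. \<Sum>i<j. (-1) ^ j * ((h i j i - h j i i) * Q j i)) =
    (\<Sum>r<k. (-1) ^ r * (\<Sum>s=Suc r..<k. h r (Suc s) s * Q r s)) +
      (\<Sum>r<k. \<Sum>j=Suc (Suc r)..k. (-1) ^ j * (h r j r * Q j r))"
proof -
  \<comment> \<open>slot \<open>s\<close> holds a field before the omitted one for \<open>s < i\<close>, and after it for \<open>i \<le> s\<close>\<close>
  have split: "(\<Sum>s<k. h i (skip i s) s * Q i s) =
      (\<Sum>s<i. h i s s * Q i s) + (\<Sum>s=i..<k. h i (Suc s) s * Q i s)" if "i < Suc k" for i
  proof -
    have "(\<Sum>s<k. h i (skip i s) s * Q i s) =
        (\<Sum>s=0..<i. h i (skip i s) s * Q i s) + (\<Sum>s=i..<k. h i (skip i s) s * Q i s)"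
      using that by (simp add: sum.atLeastLessThan_concat lessThan_atLeast0)
    then show ?thesis
      by (simp add: skip_def lessThan_atLeast0)
  qed
  have "(\<Sum>i<Suc k. (-1) ^ i * (\<Sum>s<k. h i (skip i s) s * Q i s)) =
      (\<Sum>i<Suc k. \<Sum>s<i. (-1) ^ i * (h i s s * Q i s)) +
      (\<Sum>i<Suc k. (-1) ^ i * (\<Sum>s=i..<k. h i (Suc s) s * Q i s))"
    by (subst sum.distrib[symmetric], rule sum.cong[OF refl])
      (simp add: split distrib_left sum_distrib_left)
  moreover have "(\<Sum>j<Suc k. \<Sum>i<j. (-1) ^ j * ((h i j i - h j i i) * Q j i)) =
      (\<Sum>j<Suc k. \<Sum>i<j. (-1) ^ j * (h i j i * Q j i)) -
      (\<Sum>j<Suc k. \<Sum>i<j. (-1) ^ j * (h j i i * Q j i))"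
    by (simp add: sum_subtractf[symmetric] algebra_simps del: sum.lessThan_Suc)
  moreover have "(\<Sum>i<Suc k. (-1) ^ i * (\<Sum>s=i..<k. h i (Suc s) s * Q i s)) =
      (\<Sum>i<k. (-1) ^ i * (\<Sum>s=i..<k. h i (Suc s) s * Q i s))"
    by simp
  moreover have "\<dots> = (\<Sum>i<k. (-1) ^ i * (h i (Suc i) i * Q i i)) +
      (\<Sum>i<k. (-1) ^ i * (\<Sum>s=Suc i..<k. h i (Suc s) s * Q i s))"
    by (subst sum.distrib[symmetric], rule sum.cong[OF refl])
      (simp add: sum.atLeast_Suc_lessThan distrib_left)
  moreover have "(\<Sum>j<Suc k. \<Sum>i<j. (-1) ^ j * (h i j i * Q j i)) =
      (\<Sum>i<k. \<Sum>j=Suc i..k. (-1) ^ j * (h i j i * Q j i))"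
    by (simp only: lessThan_Suc_atMost sum.nested_swap')
  moreover have "\<dots> = (\<Sum>i<k. - ((-1) ^ i * (h i (Suc i) i * Q i i))) +
      (\<Sum>i<k. \<Sum>j=Suc (Suc i)..k. (-1) ^ j * (h i j i * Q j i))"
    by (subst sum.distrib[symmetric], rule sum.cong[OF refl])
      (simp add: sum.atLeast_Suc_atMost Q)
  ultimately show ?thesis
    by (simp add: sum_negf)
qed

section \<open>The local operators in components\<close>

lemma prod_lessThan_add:
  fixes f :: "nat \<Rightarrow> 'a::comm_monoid_mult"
  shows "(\<Prod>q<a + b. f q) = (\<Prod>q<a. f q) * (\<Prod>q<b. f (a + q))"
  by (induction b) (simp_all add: mult.assoc)

lemma op_product_append:
  assumes "length As \<le> length Xs"
  shows "op_product (As @ Bs) Xs p =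
    op_product As (take (length As) Xs) p * op_product Bs (drop (length As) Xs) p"
  using assms by (simp add: op_product_def prod_lessThan_add nth_append)

lemma op_product_split:
  assumes "length As = Suc k" "i \<le> k" "s < k"
  shows "op_product As Xs p = (As ! i) (Xs ! i) p * ((As ! skip i s) (Xs ! skip i s) p *
    (\<Prod>t\<in>{..<k} - {s}. (As ! skip i t) (Xs ! skip i t) p))"
  unfolding op_product_def assms(1) using assms(2,3) by (rule prod_skip_remove)

text \<open>
  \<open>D t j\<close> is the value at \<open>p\<close> of component \<open>j\<close> of the field \<open>t\<close>.  Inserting \<open>dx\<^sup>l\<close> at position \<open>i\<close>
  leaves the factors of \<open>I\<close> at the positions enumerated by \<open>skip i\<close>.
\<close>
lemma op_product_insert_dx:
  assumes "length I = k" "i \<le> k" and D: "\<And>t j. t \<le> k \<Longrightarrow> dx c j (Xs ! t) p = D t j"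
  shows "op_product (map (dx c) (take i I @ [l] @ drop i I)) Xs p =
    D i l * (\<Prod>t<k. D (skip i t) (I ! t))"
proof -
  define As where "As = map (dx c) (take i I @ [l] @ drop i I)"
  have len: "length As = Suc k" using assms(1,2) by (simp add: As_def)
  have "op_product As Xs p = (As ! i) (Xs ! i) p * (\<Prod>t<k. (As ! skip i t) (Xs ! skip i t) p)"
    unfolding op_product_def len using assms(2) by (rule prod_skip)
  moreover have "As ! i = dx c l"
    using assms(1,2) by (simp add: As_def nth_append)
  moreover have "As ! skip i t = dx c (I ! t)" if "t < k" for t
    using assms(1,2) that by (auto simp: As_def nth_append skip_def)
  moreover have "skip i t \<le> k" if "t < k" for t
    using that by (simp add: skip_def)
  ultimately show ?thesis
    unfolding As_def[symmetric] using assms(2) by (simp add: D)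
qed

text \<open>
  A term of the first sum in \<open>S\<close>, preceded by the \<open>r\<close> factors in front of \<open>S\<close>.  Counted from 0 in the
  full product, \<open>dx\<^sup>l\<close> is at position \<open>r\<close> and the composite operator, built from slot \<open>s\<close> of \<open>I\<close>, at
  position \<open>Suc s = skip r s\<close>: the field \<open>r\<close> differentiates, and all other slots see the list of fields
  with the field \<open>r\<close> omitted.
\<close>
lemma op_product_S_first:
  assumes I: "length I = k" and rs: "r < s" "s < k" and Xs: "length Xs = Suc k"
    and D: "\<And>t j. t \<le> k \<Longrightarrow> dx c j (Xs ! t) p = D t j"
    and E: "d_dx c l (I ! s) (Xs ! Suc s) p = e"
  shows "op_product (map (dx c) (take r I)) (take r Xs) p *
      op_product ([dx c l] @ map (dx c) (take (s - r) (drop r I)) @ [d_dx c l (drop r I ! (s - r))] @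
        map (dx c) (drop (Suc s - r) (drop r I))) (drop r Xs) p =
    D r l * e * (\<Prod>t\<in>{..<k} - {s}. D (skip r t) (I ! t))"
    (is "_ * op_product ?Bs _ _ = _")
proof -
  define As where "As = map (dx c) (take r I) @ ?Bs"
  have len: "length As = Suc k" using I rs by (simp add: As_def)
  have "op_product (map (dx c) (take r I)) (take r Xs) p * op_product ?Bs (drop r Xs) p = op_product As Xs p"
    using op_product_append[of "map (dx c) (take r I)" Xs ?Bs p] I rs Xs by (simp add: As_def)
  also have "\<dots> = (As ! r) (Xs ! r) p * ((As ! skip r s) (Xs ! skip r s) p *
      (\<Prod>t\<in>{..<k} - {s}. (As ! skip r t) (Xs ! skip r t) p))"
    using rs by (intro op_product_split[OF len]) auto
  also have "As ! r = dx c l"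
    using I rs by (simp add: As_def nth_append)
  also have "skip r s = Suc s"
    using rs by (simp add: skip_def)
  also have "As ! Suc s = d_dx c l (I ! s)"
    using I rs by (simp add: As_def nth_append)
  also have "(\<Prod>t\<in>{..<k} - {s}. (As ! skip r t) (Xs ! skip r t) p) =
      (\<Prod>t\<in>{..<k} - {s}. D (skip r t) (I ! t))"
  proof (rule prod.cong[OF refl])
    fix t assume t: "t \<in> {..<k} - {s}"
    consider "t < r" | "r \<le> t" "t < s" | "s < t" using t by force
    then have "As ! skip r t = dx c (I ! t)"
    proof cases
      case 3
      then have "Suc t - r - Suc (s - r) = Suc (t - Suc s)" "r + (Suc s - r) + (t - Suc s) = t"
        using rs by auto
      with 3 show ?thesis
        using I rs t by (auto simp: As_def nth_append skip_def min_def nth_Cons split: nat.splits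
            intro!: arg_cong[where f = "\<lambda>u. dx c (I ! u)"])
    qed (use I rs t in \<open>auto simp: As_def nth_append skip_def min_def\<close>)
    then show "(As ! skip r t) (Xs ! skip r t) p = D (skip r t) (I ! t)"
      using t by (simp add: D skip_def)
  qed
  finally show ?thesis
    using rs by (simp add: D E)
qed

text \<open>
  A term of the second sum in \<open>S\<close>.  The composite operator, built from slot \<open>r\<close> of \<open>I\<close>, is at position
  \<open>j\<close>, and \<open>dx\<^sup>l\<close> at position \<open>r = skip j r\<close>: the field \<open>r\<close> differentiates the field \<open>j\<close>, which has
  taken its place in slot \<open>r\<close>, as in a bracket; all other slots see the list with the field \<open>j\<close>
  omitted.
\<close>
lemma op_product_S_second:
  assumes I: "length I = k" and rj: "Suc r < j" "j \<le> k" and Xs: "length Xs = Suc k"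
    and D: "\<And>t i. t \<le> k \<Longrightarrow> dx c i (Xs ! t) p = D t i"
    and E: "d_dx c l (I ! r) (Xs ! j) p = e"
  shows "op_product (map (dx c) (take r I)) (take r Xs) p *
      op_product ([dx c l] @ map (dx c) (take (j - Suc r) (tl (drop r I))) @ [d_dx c l (hd (drop r I))] @
        map (dx c) (drop (j - r) (drop r I))) (drop r Xs) p =
    D r l * e * (\<Prod>t\<in>{..<k} - {r}. D (skip j t) (I ! t))"
    (is "_ * op_product ?Bs _ _ = _")
proof -
  define As where "As = map (dx c) (take r I) @ ?Bs"
  have hd: "hd (drop r I) = I ! r" and tl: "tl (drop r I) = drop (Suc r) I"
    using I rj by (auto simp: hd_drop_conv_nth drop_Suc tl_drop)
  have len: "length As = Suc k" using I rj by (simp add: As_def)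
  have "op_product (map (dx c) (take r I)) (take r Xs) p * op_product ?Bs (drop r Xs) p = op_product As Xs p"
    using op_product_append[of "map (dx c) (take r I)" Xs ?Bs p] I rj Xs by (simp add: As_def)
  also have "\<dots> = (As ! j) (Xs ! j) p * ((As ! skip j r) (Xs ! skip j r) p *
      (\<Prod>t\<in>{..<k} - {r}. (As ! skip j t) (Xs ! skip j t) p))"
    using rj by (intro op_product_split[OF len]) auto
  also have "As ! j = d_dx c l (I ! r)"
    unfolding As_def hd tl using I rj by (simp add: nth_append)
  also have "skip j r = r"
    using rj by (simp add: skip_def)
  also have "As ! r = dx c l"
    using I rj by (simp add: As_def nth_append)
  also have "(\<Prod>t\<in>{..<k} - {r}. (As ! skip j t) (Xs ! skip j t) p) =
      (\<Prod>t\<in>{..<k} - {r}. D (skip j t) (I ! t))"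
  proof (rule prod.cong[OF refl])
    fix t assume t: "t \<in> {..<k} - {r}"
    consider "t < r" | "r < t" "t < j" | "j \<le> t" using t by force
    then have "As ! skip j t = dx c (I ! t)"
    proof cases
      case 3
      then have "Suc t - r - Suc (j - Suc r) = Suc (t - j)" "r + (j - r) + (t - j) = t"
        using rj by auto
      with 3 show ?thesis
        unfolding As_def hd tl
        using I rj t by (auto simp: nth_append skip_def min_def nth_Cons split: nat.splits
            intro!: arg_cong[where f = "\<lambda>u. dx c (I ! u)"])
    next
      case 2
      then have "Suc r + (t - Suc r) = t" by auto
      with 2 show ?thesis
        unfolding As_def hd tl
        using I rj t by (auto simp: nth_append skip_def min_def nth_Cons split: nat.splits
            intro!: arg_cong[where f = "\<lambda>u. dx c (I ! u)"])
    qed (use I rj t in \<open>auto simp: As_def nth_append skip_def min_def\<close>)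
    then show "(As ! skip j t) (Xs ! skip j t) p = D (skip j t) (I ! t)"
      using t by (simp add: D skip_def)
  qed
  finally show ?thesis
    using rj by (simp add: D E)
qed

text \<open>
  With \<open>m\<close> the position in \<open>S\<close>, counted from 1, of the composite operator, the substitutions are
  \<open>s = m + r - 2\<close> in the first and \<open>j = m + r - 1\<close> in the second sum.  The inner sums over \<open>l\<close> are the
  derivative along the field \<open>r\<close> of a component of another field.
\<close>
lemma op_tensor_S_op:
  assumes I: "length I = k" "set I \<subseteq> {..<n}" and r: "Suc r < k" and Xs: "length Xs = Suc k"
    and D: "\<And>t i. t \<le> k \<Longrightarrow> dx c i (Xs ! t) p = D t i"
    and E: "\<And>t i l. t \<le> k \<Longrightarrow> i < n \<Longrightarrow> l < n \<Longrightarrow> d_dx c l i (Xs ! t) p = E l t i"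
  shows "op_tensor (map (dx c) (take r I)) (S_op n c (drop r I)) Xs p =
    (\<Sum>s=Suc r..<k. (\<Sum>l<n. D r l * E l (Suc s) (I ! s)) * (\<Prod>t\<in>{..<k} - {s}. D (skip r t) (I ! t))) +
    (\<Sum>j=Suc (Suc r)..k. (-1) ^ (r + j) * ((\<Sum>l<n. D r l * E l j (I ! r)) * (\<Prod>t\<in>{..<k} - {r}. D (skip j t) (I ! t))))"
proof -
  have In: "I ! t < n" if "t < k" for t
    using I that nth_mem by fastforce
  have "op_tensor (map (dx c) (take r I)) (S_op n c (drop r I)) Xs p =
    (\<Sum>m=3..k - r + 1. \<Sum>l<n. op_product (map (dx c) (take r I)) (take r Xs) p *
        op_product ([dx c l] @ map (dx c) (take (m - 2) (drop r I)) @ [d_dx c l (drop r I ! (m - 2))] @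
          map (dx c) (drop (m - 1) (drop r I))) (drop r Xs) p) +
    (\<Sum>m=3..k - r + 1. (-1) ^ (m + 1) * (\<Sum>l<n. op_product (map (dx c) (take r I)) (take r Xs) p *
        op_product ([dx c l] @ map (dx c) (take (m - 2) (tl (drop r I))) @ [d_dx c l (hd (drop r I))] @
          map (dx c) (drop (m - 1) (drop r I))) (drop r Xs) p))"
    using I r by (simp add: op_tensor_def S_op_def distrib_left sum_distrib_left mult.left_commute)
  also have "(\<Sum>m=3..k - r + 1. \<Sum>l<n. op_product (map (dx c) (take r I)) (take r Xs) p *
        op_product ([dx c l] @ map (dx c) (take (m - 2) (drop r I)) @ [d_dx c l (drop r I ! (m - 2))] @
          map (dx c) (drop (m - 1) (drop r I))) (drop r Xs) p) =
      (\<Sum>s=Suc r..<k. (\<Sum>l<n. D r l * E l (Suc s) (I ! s)) * (\<Prod>t\<in>{..<k} - {s}. D (skip r t) (I ! t)))"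
  proof (rule sum.reindex_bij_witness[where i = "\<lambda>s. s - r + 2" and j = "\<lambda>m. m + r - 2"])
    fix m assume m: "m \<in> {3..k - r + 1}"
    define s where "s = m + r - 2"
    have s: "m - 2 = s - r" "m - 1 = Suc s - r" "r < s" "s < k"
      using m r by (auto simp: s_def)
    show "(\<Sum>l<n. D r l * E l (Suc (m + r - 2)) (I ! (m + r - 2))) *
        (\<Prod>t\<in>{..<k} - {m + r - 2}. D (skip r t) (I ! t)) =
      (\<Sum>l<n. op_product (map (dx c) (take r I)) (take r Xs) p *
        op_product ([dx c l] @ map (dx c) (take (m - 2) (drop r I)) @ [d_dx c l (drop r I ! (m - 2))] @
          map (dx c) (drop (m - 1) (drop r I))) (drop r Xs) p)"
      unfolding s_def[symmetric] s(1,2) sum_distrib_right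
      using s(3,4) In
      by (intro sum.cong refl op_product_S_first[OF I(1) s(3,4) Xs D E, symmetric]) auto
  qed (use r in auto)
  also have "(\<Sum>m=3..k - r + 1. (-1) ^ (m + 1) * (\<Sum>l<n. op_product (map (dx c) (take r I)) (take r Xs) p *
        op_product ([dx c l] @ map (dx c) (take (m - 2) (tl (drop r I))) @ [d_dx c l (hd (drop r I))] @
          map (dx c) (drop (m - 1) (drop r I))) (drop r Xs) p)) =
      (\<Sum>j=Suc (Suc r)..k. (-1) ^ (r + j) * ((\<Sum>l<n. D r l * E l j (I ! r)) * (\<Prod>t\<in>{..<k} - {r}. D (skip j t) (I ! t))))"
  proof (rule sum.reindex_bij_witness[where i = "\<lambda>j. j - r + 1" and j = "\<lambda>m. m + r - 1"])
    fix m assume m: "m \<in> {3..k - r + 1}"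
    define j where "j = m + r - 1"
    have j: "m - 2 = j - Suc r" "m - 1 = j - r" "Suc r < j" "j \<le> k"
      using m r by (auto simp: j_def)
    have "even (m + 1) \<longleftrightarrow> even (r + j)"
      using m by (auto simp: j_def)
    then have sgn: "(-1::real) ^ (m + 1) = (-1) ^ (r + j)"
      by (simp add: minus_one_power_iff del: power_Suc)
    show "(-1) ^ (r + (m + r - 1)) * ((\<Sum>l<n. D r l * E l (m + r - 1) (I ! r)) *
        (\<Prod>t\<in>{..<k} - {r}. D (skip (m + r - 1) t) (I ! t))) =
      (-1) ^ (m + 1) * (\<Sum>l<n. op_product (map (dx c) (take r I)) (take r Xs) p *
        op_product ([dx c l] @ map (dx c) (take (m - 2) (tl (drop r I))) @ [d_dx c l (hd (drop r I))] @
          map (dx c) (drop (m - 1) (drop r I))) (drop r Xs) p)"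
      unfolding j_def[symmetric] j(1,2) sgn sum_distrib_right
      using j(3,4) In r
      by (intro arg_cong2[where f = times] sum.cong refl
          op_product_S_second[OF I(1) j(3,4) Xs D E, symmetric]) auto
  qed (use r in auto)
  finally show ?thesis .
qed

section \<open>The local formula\<close>

lemma finite_multi_indices: "finite (multi_indices n k)"
  unfolding multi_indices_def using finite_lists_length_eq[of "{..<n}" k] by (simp add: conj_commute)

lemma multi_indices_nth_less: "I \<in> multi_indices n k \<Longrightarrow> r < k \<Longrightarrow> I ! r < n"
  using nth_mem by (fastforce simp: multi_indices_def)

context smooth_atlas
begin

lemma coord_deriv_cong:
  assumes c: "(U, x) \<in> A" and p: "p \<in> U" and l: "l < n" and eq: "\<forall>\<^sub>F q in nhds p. f q = g q"
  shows "coord_deriv (U, x) l f p = coord_deriv (U, x) l g p"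
proof -
  obtain W where W: "open W" "p \<in> W" "\<And>q. q \<in> W \<Longrightarrow> f q = g q"
    using eq by (auto simp: eventually_nhds)
  have "partial_deriv l (\<lambda>z. f (inv_into U x z)) (x p) = partial_deriv l (\<lambda>z. g (inv_into U x z)) (x p)"
    by (rule partial_deriv_cong[OF chart_image_openin[OF c W(1)] _ l])
      (use p W in \<open>auto simp: chart_inv_into[OF c]\<close>)
  then show ?thesis by (simp add: coord_deriv_def)
qed

lemma dx_smooth:
  assumes c: "(U, x) \<in> A" and X: "X \<in> vector_fields n A U" and i: "i < n"
  shows "dx (U, x) i X \<in> smooth_functions n A U"
  using vector_field_smooth[OF X chart_open[OF c] order_refl smooth_functions_chart_coordinate[OF c i]]
  by (simp add: dx_def[abs_def] coord_covector_def)

lemma vector_field_expansion: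
  assumes c: "(U, x) \<in> A" and p: "p \<in> U" and X: "X \<in> vector_fields n A U" and f: "smooth_near n A p f"
  shows "X p f = (\<Sum>l<n. dx (U, x) l X p * coord_deriv (U, x) l f p)"
  using tangent_coordinate_expansion[OF c p vector_field_tangent[OF X p] f] by (simp add: dx_def)

lemma dx_lie_bracket:
  assumes c: "(U, x) \<in> A" and p: "p \<in> U" and i: "i < n"
    and XY: "X \<in> vector_fields n A U" "Y \<in> vector_fields n A U"
  shows "coord_covector (U, x) i (lie_bracket n A X Y p) =
    (\<Sum>l<n. dx (U, x) l X p * d_dx (U, x) l i Y p) - (\<Sum>l<n. dx (U, x) l Y p * d_dx (U, x) l i X p)"
proof -
  have near: "smooth_near n A p f" if "f \<in> smooth_functions n A U" for f
    by (rule smooth_nearI[OF chart_open[OF c] p that])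
  have "coord_covector (U, x) i (lie_bracket n A X Y p) = X p (dx (U, x) i Y) - Y p (dx (U, x) i X)"
    by (simp add: coord_covector_def lie_bracket_apply[OF near[OF smooth_functions_chart_coordinate[OF c i]]]
        dx_def[abs_def])
  then show ?thesis
    by (simp add: vector_field_expansion[OF c p XY(1) near[OF dx_smooth[OF c XY(2) i]]]
        vector_field_expansion[OF c p XY(2) near[OF dx_smooth[OF c XY(1) i]]] d_dx_def)
qed

text \<open>
  Near \<open>p\<close>, \<open>\<omega>\<close> applied to fields is a sum of products of smooth functions, so the Leibniz rule for
  the tangent vectors \<open>(Xs ! i) p\<close> and the coordinate formula for brackets express the coboundary by
  the components \<open>D\<close> of the fields at \<open>p\<close>, their partial derivatives \<open>E\<close> and those of the \<open>a\<^sub>I\<close>.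
  Derivatives of the \<open>a\<^sub>I\<close> give the first sum; the rest is treated by \<open>leibniz_cancellation\<close> separately
  for each \<open>I\<close>.  The components are named by \<open>D\<close> and \<open>E\<close>
  so that the same expression arises for any two lists of fields with equal germs at \<open>p\<close>.
\<close>
lemma leibniz_coboundary_local_formula:
  fixes a :: "nat list \<Rightarrow> 'm \<Rightarrow> real"
  assumes c: "(U, x) \<in> A" and p: "p \<in> U"
    and a: "\<And>I. I \<in> multi_indices n k \<Longrightarrow> a I \<in> smooth_functions n A U"
    and \<omega>: "\<And>q vs. q \<in> U \<Longrightarrow> length vs = k \<Longrightarrow> set vs \<subseteq> tangent_space n A q \<Longrightarrow>
           \<omega> q vs = (\<Sum>I\<in>multi_indices n k. a I q * (\<Prod>r<k. coord_covector (U, x) (I ! r) (vs ! r)))"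
    and Xs: "length Xs = Suc k" "set Xs \<subseteq> vector_fields n A U"
    and D: "\<And>t i. t \<le> k \<Longrightarrow> dx (U, x) i (Xs ! t) p = D t i"
    and E: "\<And>t i l. t \<le> k \<Longrightarrow> i < n \<Longrightarrow> l < n \<Longrightarrow> d_dx (U, x) l i (Xs ! t) p = E l t i"
  shows "leibniz_coboundary n A (tensor_operator \<omega>) Xs p =
    (\<Sum>I\<in>multi_indices n k. \<Sum>l<n. coord_deriv (U, x) l (a I) p *
      (\<Sum>i<Suc k. (-1) ^ i * (D i l * (\<Prod>t<k. D (skip i t) (I ! t))))) +
    (\<Sum>I\<in>multi_indices n k. a I p *
      ((\<Sum>r<k. (-1) ^ r * (\<Sum>s=Suc r..<k. (\<Sum>l<n. D r l * E l (Suc s) (I ! s)) *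
          (\<Prod>t\<in>{..<k} - {s}. D (skip r t) (I ! t)))) +
       (\<Sum>r<k. \<Sum>j=Suc (Suc r)..k. (-1) ^ j * ((\<Sum>l<n. D r l * E l j (I ! r)) *
          (\<Prod>t\<in>{..<k} - {r}. D (skip j t) (I ! t))))))"
proof -
  define h where "h = (\<lambda>s t i. \<Sum>l<n. D s l * E l t i)"
  define Q where "Q = (\<lambda>I i s. \<Prod>t\<in>{..<k} - {s}. D (skip i t) (I ! t))"
  let ?M = "multi_indices n k"
  have U: "open U" by (rule chart_open[OF c])
  have near: "smooth_near n A p f" if "f \<in> smooth_functions n A U" for f
    by (rule smooth_nearI[OF U p that])
  have X: "Xs ! t \<in> vector_fields n A U" if "t \<le> k" for t
    using Xs that nth_mem[of t Xs] by auto
  have h: "(Xs ! s) p (dx (U, x) i (Xs ! t)) = h s t i" if "s \<le> k" "t \<le> k" "i < n" for s t i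
    using that by (simp add: vector_field_expansion[OF c p X near[OF dx_smooth[OF c X]]] h_def D
        d_dx_def[symmetric] E)
  have skip_le: "skip i t \<le> k" if "t < k" for i t
    using that by (simp add: skip_def)
  \<comment> \<open>derivatives of values of \<open>\<omega>\<close>, by the Leibniz rule for the tangent vector \<open>(Xs ! i) p\<close>\<close>
  have first: "(Xs ! i) p (tensor_operator \<omega> (delete_nth i Xs)) =
      (\<Sum>I\<in>?M. (\<Sum>l<n. coord_deriv (U, x) l (a I) p * (D i l * (\<Prod>t<k. D (skip i t) (I ! t)))) +
        a I p * (\<Sum>s<k. h i (skip i s) (I ! s) * Q I i s))" if i: "i < Suc k" for i
  proof -
    define Zs where "Zs = delete_nth i Xs"
    have Zs: "length Zs = k" "set Zs \<subseteq> vector_fields n A U"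
      using Xs i set_delete_nth_subset[of i Xs] by (auto simp: Zs_def length_delete_nth)
    have Z: "Zs ! t = Xs ! skip i t" if "t < k" for t
      using Xs i that by (simp add: Zs_def delete_nth_nth)
    define G where "G = (\<lambda>I q. \<Prod>r<k. dx (U, x) (I ! r) (Zs ! r) q)"
    have v: "(Xs ! i) p \<in> tangent_space n A p"
      using i by (intro vector_field_tangent[OF X p]) auto
    have tens: "tensor_operator \<omega> Zs q = (\<Sum>I\<in>?M. a I q * G I q)" if q: "q \<in> U" for q
    proof -
      have "set (map (\<lambda>X. X q) Zs) \<subseteq> tangent_space n A q"
        using Zs(2) vector_field_tangent[OF _ q] by auto
      then have "tensor_operator \<omega> Zs q =
          (\<Sum>I\<in>?M. a I q * (\<Prod>r<k. coord_covector (U, x) (I ! r) (map (\<lambda>X. X q) Zs ! r)))"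
        unfolding tensor_operator_def using \<omega>[OF q, of "map (\<lambda>X. X q) Zs"] Zs(1) by simp
      also have "\<dots> = (\<Sum>I\<in>?M. a I q * G I q)"
        unfolding G_def using Zs(1) by (intro sum.cong refl arg_cong2[where f = times] prod.cong) (auto simp: dx_def)
      finally show ?thesis .
    qed
    have fac: "smooth_near n A p (dx (U, x) (I ! r) (Zs ! r))" if "I \<in> ?M" "r < k" for I r
      using that Zs by (intro near dx_smooth[OF c] multi_indices_nth_less) auto
    have G: "smooth_near n A p (G I)" if "I \<in> ?M" for I
      unfolding G_def using fac[OF that] by (intro smooth_near_prod) auto
    have "(Xs ! i) p (tensor_operator \<omega> Zs) = (Xs ! i) p (\<lambda>q. \<Sum>I\<in>?M. a I q * G I q)"
    proof (rule tangent_cong[OF v])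
      show "smooth_near n A p (\<lambda>q. \<Sum>I\<in>?M. a I q * G I q)"
        by (intro smooth_near_sum finite_multi_indices smooth_near_mult near a G)
      show "\<forall>\<^sub>F q in nhds p. tensor_operator \<omega> Zs q = (\<Sum>I\<in>?M. a I q * G I q)"
        using eventually_nhds_in_open[OF U p] by eventually_elim (rule tens)
    qed
    also have "\<dots> = (\<Sum>I\<in>?M. (Xs ! i) p (\<lambda>q. a I q * G I q))"
      by (rule tangent_sum[OF v finite_multi_indices smooth_near_mult[OF near[OF a] G]])
    also have "\<dots> = (\<Sum>I\<in>?M. a I p * (Xs ! i) p (G I) + G I p * (Xs ! i) p (a I))"
      by (intro sum.cong refl tangent_mult[OF v near[OF a] G])
    also have "\<dots> = (\<Sum>I\<in>?M. (\<Sum>l<n. coord_deriv (U, x) l (a I) p * (D i l * (\<Prod>t<k. D (skip i t) (I ! t)))) +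
        a I p * (\<Sum>s<k. h i (skip i s) (I ! s) * Q I i s))"
    proof (rule sum.cong[OF refl])
      fix I assume I: "I \<in> ?M"
      have Dt: "dx (U, x) (I ! t) (Zs ! t) p = D (skip i t) (I ! t)" if "t < k" for t
        using that by (simp add: Z D skip_le)
      have "(Xs ! i) p (a I) = (\<Sum>l<n. D i l * coord_deriv (U, x) l (a I) p)"
        using i vector_field_expansion[OF c p X near[OF a[OF I]]] by (simp add: D)
      moreover have "G I p = (\<Prod>t<k. D (skip i t) (I ! t))"
        unfolding G_def by (intro prod.cong refl) (simp add: Dt)
      moreover have "(Xs ! i) p (G I) = (\<Sum>s<k. h i (skip i s) (I ! s) * Q I i s)"
      proof -
        have "(Xs ! i) p (G I) = (\<Sum>s<k. (Xs ! i) p (dx (U, x) (I ! s) (Zs ! s)) *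
            (\<Prod>r\<in>{..<k} - {s}. dx (U, x) (I ! r) (Zs ! r) p))"
          unfolding G_def using fac[OF I] by (intro tangent_prod[OF v]) auto
        also have "\<dots> = (\<Sum>s<k. h i (skip i s) (I ! s) * Q I i s)"
          unfolding Q_def using i multi_indices_nth_less[OF I]
          by (intro sum.cong refl arg_cong2[where f = times] prod.cong) (auto simp: Z D h skip_le)
        finally show ?thesis .
      qed
      ultimately show "a I p * (Xs ! i) p (G I) + G I p * (Xs ! i) p (a I) =
          (\<Sum>l<n. coord_deriv (U, x) l (a I) p * (D i l * (\<Prod>t<k. D (skip i t) (I ! t)))) +
          a I p * (\<Sum>s<k. h i (skip i s) (I ! s) * Q I i s)"
        by (simp add: sum_distrib_left mult_ac)
    qed
    finally show ?thesis by (simp add: Zs_def)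
  qed
  \<comment> \<open>values of \<open>\<omega>\<close> at brackets; the entry \<open>i < j\<close> keeps its position when entry \<open>j\<close> is deleted\<close>
  have second: "tensor_operator \<omega> (delete_nth j (Xs[i := lie_bracket n A (Xs ! i) (Xs ! j)])) p =
      (\<Sum>I\<in>?M. a I p * ((h i j (I ! i) - h j i (I ! i)) * Q I j i))" if ij: "i < j" "j < Suc k" for i j
  proof -
    define B where "B = lie_bracket n A (Xs ! i) (Xs ! j)"
    define vs where "vs = map (\<lambda>X. X p) (delete_nth j (Xs[i := B]))"
    have B: "B p \<in> tangent_space n A p"
      unfolding B_def using ij by (intro lie_bracket_tangent[OF U p] X) auto
    have vs: "length vs = k"
      using Xs ij by (simp add: vs_def length_delete_nth)
    have nth: "vs ! t = (if t = i then B p else (Xs ! skip j t) p)" if "t < k" for t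
      using that Xs ij by (auto simp: vs_def length_delete_nth delete_nth_nth nth_list_update skip_def)
    have "vs ! t \<in> tangent_space n A p" if "t < k" for t
      using that B by (simp add: nth vector_field_tangent[OF X p] skip_le)
    then have "set vs \<subseteq> tangent_space n A p"
      using vs by (auto simp: in_set_conv_nth)
    then have "tensor_operator \<omega> (delete_nth j (Xs[i := B])) p =
        (\<Sum>I\<in>?M. a I p * (\<Prod>r<k. coord_covector (U, x) (I ! r) (vs ! r)))"
      using \<omega>[OF p vs] by (simp add: tensor_operator_def vs_def)
    also have "\<dots> = (\<Sum>I\<in>?M. a I p * ((h i j (I ! i) - h j i (I ! i)) * Q I j i))"
    proof (intro sum.cong refl arg_cong2[where f = times])
      fix I assume I: "I \<in> ?M"
      have "(\<Prod>r<k. coord_covector (U, x) (I ! r) (vs ! r)) = coord_covector (U, x) (I ! i) (vs ! i) *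
          (\<Prod>r\<in>{..<k} - {i}. coord_covector (U, x) (I ! r) (vs ! r))"
        using ij by (intro prod.remove) auto
      also have "coord_covector (U, x) (I ! i) (vs ! i) = h i j (I ! i) - h j i (I ! i)"
        using ij multi_indices_nth_less[OF I, of i]
        by (simp add: nth B_def dx_lie_bracket[OF c p _ X X] h_def D E)
      also have "(\<Prod>r\<in>{..<k} - {i}. coord_covector (U, x) (I ! r) (vs ! r)) = Q I j i"
        unfolding Q_def by (intro prod.cong refl) (auto simp: nth D[OF skip_le, symmetric] dx_def)
      finally show "(\<Prod>r<k. coord_covector (U, x) (I ! r) (vs ! r)) =
          (h i j (I ! i) - h j i (I ! i)) * Q I j i" .
    qed
    finally show ?thesis by (simp add: B_def)
  qed
  have "leibniz_coboundary n A (tensor_operator \<omega>) Xs p =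
      (\<Sum>i<Suc k. (-1) ^ i * (\<Sum>I\<in>?M. (\<Sum>l<n. coord_deriv (U, x) l (a I) p * (D i l * (\<Prod>t<k. D (skip i t) (I ! t)))) +
        a I p * (\<Sum>s<k. h i (skip i s) (I ! s) * Q I i s))) +
      (\<Sum>j<Suc k. \<Sum>i<j. (-1) ^ j * (\<Sum>I\<in>?M. a I p * ((h i j (I ! i) - h j i (I ! i)) * Q I j i)))"
    unfolding leibniz_coboundary_def Xs(1)
    by (intro arg_cong2[where f = plus] sum.cong refl arg_cong2[where f = times]) (auto simp: first second)
  also have "(\<Sum>i<Suc k. (-1) ^ i * (\<Sum>I\<in>?M. (\<Sum>l<n. coord_deriv (U, x) l (a I) p * (D i l * (\<Prod>t<k. D (skip i t) (I ! t)))) +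
        a I p * (\<Sum>s<k. h i (skip i s) (I ! s) * Q I i s))) =
      (\<Sum>I\<in>?M. \<Sum>l<n. coord_deriv (U, x) l (a I) p * (\<Sum>i<Suc k. (-1) ^ i * (D i l * (\<Prod>t<k. D (skip i t) (I ! t))))) +
      (\<Sum>I\<in>?M. a I p * (\<Sum>i<Suc k. (-1) ^ i * (\<Sum>s<k. h i (skip i s) (I ! s) * Q I i s)))"
    unfolding distrib_left sum.distrib sum_distrib_left
    by (subst (1 2) sum.swap[of _ ?M], subst sum.swap[of _ "{..<n}" "{..<Suc k}"])
      (simp add: mult.left_commute del: sum.lessThan_Suc)
  also have "(\<Sum>j<Suc k. \<Sum>i<j. (-1) ^ j * (\<Sum>I\<in>?M. a I p * ((h i j (I ! i) - h j i (I ! i)) * Q I j i))) =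
      (\<Sum>I\<in>?M. a I p * (\<Sum>j<Suc k. \<Sum>i<j. (-1) ^ j * ((h i j (I ! i) - h j i (I ! i)) * Q I j i)))"
    unfolding sum_distrib_left
    by (subst sum.swap[of _ ?M], subst sum.swap[of _ ?M]) (simp add: mult.left_commute del: sum.lessThan_Suc)
  finally have expand: "leibniz_coboundary n A (tensor_operator \<omega>) Xs p =
      (\<Sum>I\<in>?M. \<Sum>l<n. coord_deriv (U, x) l (a I) p * (\<Sum>i<Suc k. (-1) ^ i * (D i l * (\<Prod>t<k. D (skip i t) (I ! t))))) +
      (\<Sum>I\<in>?M. a I p * ((\<Sum>i<Suc k. (-1) ^ i * (\<Sum>s<k. h i (skip i s) (I ! s) * Q I i s)) +
        (\<Sum>j<Suc k. \<Sum>i<j. (-1) ^ j * ((h i j (I ! i) - h j i (I ! i)) * Q I j i))))"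
    by (simp only: distrib_left sum.distrib add.assoc)
  have cancel: "(\<Sum>i<Suc k. (-1) ^ i * (\<Sum>s<k. h i (skip i s) (I ! s) * Q I i s)) +
        (\<Sum>j<Suc k. \<Sum>i<j. (-1) ^ j * ((h i j (I ! i) - h j i (I ! i)) * Q I j i)) =
      (\<Sum>r<k. (-1) ^ r * (\<Sum>s=Suc r..<k. h r (Suc s) (I ! s) * Q I r s)) +
      (\<Sum>r<k. \<Sum>j=Suc (Suc r)..k. (-1) ^ j * (h r j (I ! r) * Q I j r))" for I
  proof (rule leibniz_cancellation[where h = "\<lambda>i j s. h i j (I ! s)"])
    show "Q I (Suc i) i = Q I i i" for i
      unfolding Q_def by (intro prod.cong refl) (auto simp: skip_def)
  qed
  show ?thesis
    unfolding expand cancel by (simp only: h_def Q_def)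
qed

text \<open>
  For comparison with \<open>leibniz_coboundary_local_formula\<close>.  The sums over \<open>r\<close> may run up to \<open>k - 1\<close>: for
  \<open>r = k - 1\<close> both inner sums are empty.
\<close>
lemma local_operators_formula:
  assumes k: "2 \<le> k" and Xs: "length Xs = Suc k"
    and D: "\<And>t i. t \<le> k \<Longrightarrow> dx c i (Xs ! t) p = D t i"
    and E: "\<And>t i l. t \<le> k \<Longrightarrow> i < n \<Longrightarrow> l < n \<Longrightarrow> d_dx c l i (Xs ! t) p = E l t i"
  shows "L_op n c k a Xs p +
    (\<Sum>I\<in>multi_indices n k. a I p *
      (\<Sum>r=0..k-2. (-1) ^ r * op_tensor (map (dx c) (take r I)) (S_op n c (drop r I)) Xs p)) =
    (\<Sum>I\<in>multi_indices n k. \<Sum>l<n. coord_deriv c l (a I) p *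
      (\<Sum>i<Suc k. (-1) ^ i * (D i l * (\<Prod>t<k. D (skip i t) (I ! t))))) +
    (\<Sum>I\<in>multi_indices n k. a I p *
      ((\<Sum>r<k. (-1) ^ r * (\<Sum>s=Suc r..<k. (\<Sum>l<n. D r l * E l (Suc s) (I ! s)) *
          (\<Prod>t\<in>{..<k} - {s}. D (skip r t) (I ! t)))) +
       (\<Sum>r<k. \<Sum>j=Suc (Suc r)..k. (-1) ^ j * ((\<Sum>l<n. D r l * E l j (I ! r)) *
          (\<Prod>t\<in>{..<k} - {r}. D (skip j t) (I ! t))))))"
proof (intro arg_cong2[where f = plus])
  have L: "(\<Sum>j=1..k+1. (-1) ^ (j + 1) * op_product (map (dx c) (take (j - 1) I @ [l] @ drop (j - 1) I)) Xs p) =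
      (\<Sum>i<Suc k. (-1) ^ i * (D i l * (\<Prod>t<k. D (skip i t) (I ! t))))"
    if I: "I \<in> multi_indices n k" for I l
  proof (rule sum.reindex_bij_witness[where i = Suc and j = "\<lambda>j. j - 1"])
    fix j assume j: "j \<in> {1..k + 1}"
    then obtain i where i: "j = Suc i" "i \<le> k" by (cases j) auto
    show "(-1) ^ (j - 1) * (D (j - 1) l * (\<Prod>t<k. D (skip (j - 1) t) (I ! t))) =
        (-1) ^ (j + 1) * op_product (map (dx c) (take (j - 1) I @ [l] @ drop (j - 1) I)) Xs p"
      using op_product_insert_dx[OF _ i(2) D, of I l] I i(1) by (simp add: multi_indices_def)
  qed auto
  show "L_op n c k a Xs p = (\<Sum>I\<in>multi_indices n k. \<Sum>l<n. coord_deriv c l (a I) p *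
      (\<Sum>i<Suc k. (-1) ^ i * (D i l * (\<Prod>t<k. D (skip i t) (I ! t)))))"
    unfolding L_op_def by (intro sum.cong refl) (simp only: L)
next
  show "(\<Sum>I\<in>multi_indices n k. a I p *
      (\<Sum>r=0..k-2. (-1) ^ r * op_tensor (map (dx c) (take r I)) (S_op n c (drop r I)) Xs p)) =
    (\<Sum>I\<in>multi_indices n k. a I p *
      ((\<Sum>r<k. (-1) ^ r * (\<Sum>s=Suc r..<k. (\<Sum>l<n. D r l * E l (Suc s) (I ! s)) *
          (\<Prod>t\<in>{..<k} - {s}. D (skip r t) (I ! t)))) +
       (\<Sum>r<k. \<Sum>j=Suc (Suc r)..k. (-1) ^ j * ((\<Sum>l<n. D r l * E l j (I ! r)) *
          (\<Prod>t\<in>{..<k} - {r}. D (skip j t) (I ! t))))))"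
  proof (intro sum.cong refl arg_cong2[where f = times])
    fix I assume "I \<in> multi_indices n k"
    then have I: "length I = k" "set I \<subseteq> {..<n}" by (auto simp: multi_indices_def)
    define f where "f = (\<lambda>r. \<Sum>s=Suc r..<k. (\<Sum>l<n. D r l * E l (Suc s) (I ! s)) *
        (\<Prod>t\<in>{..<k} - {s}. D (skip r t) (I ! t)))"
    define g where "g = (\<lambda>r j. (\<Sum>l<n. D r l * E l j (I ! r)) * (\<Prod>t\<in>{..<k} - {r}. D (skip j t) (I ! t)))"
    have sgn: "(-1::real) ^ r * ((-1) ^ (r + j) * y) = (-1) ^ j * y" for r j y
      by (simp add: power_add flip: mult.assoc power_mult_distrib)
    have "(\<Sum>r=0..k-2. (-1) ^ r * op_tensor (map (dx c) (take r I)) (S_op n c (drop r I)) Xs p) =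
        (\<Sum>r=0..k-2. (-1) ^ r * f r + (\<Sum>j=Suc (Suc r)..k. (-1) ^ j * g r j))"
    proof (rule sum.cong[OF refl])
      fix r assume "r \<in> {0..k - 2}"
      then have "Suc r < k" using k by auto
      from op_tensor_S_op[OF I this Xs D E]
      show "(-1) ^ r * op_tensor (map (dx c) (take r I)) (S_op n c (drop r I)) Xs p =
          (-1) ^ r * f r + (\<Sum>j=Suc (Suc r)..k. (-1) ^ j * g r j)"
        by (simp add: f_def g_def distrib_left sum_distrib_left[of "(-1) ^ r" _ "{Suc (Suc r)..k}"] sgn)
    qed
    also have "\<dots> = (\<Sum>r<k. (-1) ^ r * f r + (\<Sum>j=Suc (Suc r)..k. (-1) ^ j * g r j))"
    proof (rule sum.mono_neutral_left)
      show "\<forall>r\<in>{..<k} - {0..k - 2}. (-1) ^ r * f r + (\<Sum>j=Suc (Suc r)..k. (-1) ^ j * g r j) = 0"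
      proof
        fix r assume "r \<in> {..<k} - {0..k - 2}"
        then have "Suc r = k" by auto
        then show "(-1) ^ r * f r + (\<Sum>j=Suc (Suc r)..k. (-1) ^ j * g r j) = 0"
          by (simp add: f_def)
      qed
    qed (use k in auto)
    finally show "(\<Sum>r=0..k-2. (-1) ^ r * op_tensor (map (dx c) (take r I)) (S_op n c (drop r I)) Xs p) =
       (\<Sum>r<k. (-1) ^ r * (\<Sum>s=Suc r..<k. (\<Sum>l<n. D r l * E l (Suc s) (I ! s)) *
          (\<Prod>t\<in>{..<k} - {s}. D (skip r t) (I ! t)))) +
       (\<Sum>r<k. \<Sum>j=Suc (Suc r)..k. (-1) ^ j * ((\<Sum>l<n. D r l * E l j (I ! r)) *
          (\<Prod>t\<in>{..<k} - {r}. D (skip j t) (I ! t))))"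
      by (simp only: sum.distrib f_def g_def)
  qed
qed

end

theorem theorem4p1:
  fixes n k :: nat
    and A :: "('m::{t2_space,second_countable_topology}) chart set"
    and U :: "'m set" and x :: "'m \<Rightarrow> nat \<Rightarrow> real"
    and \<omega> :: "'m \<Rightarrow> 'm functional list \<Rightarrow> real"
    and a :: "nat list \<Rightarrow> 'm \<Rightarrow> real"
    and Xs :: "'m vector_field list" and p :: 'm
  assumes "smooth_manifold n A"
    and "k \<ge> 2"
    and "is_tensor n A k \<omega>"
    and "(U, x) \<in> A"
    and "\<And>I. I \<in> multi_indices n k \<Longrightarrow> a I \<in> smooth_functions n A U"
    and "\<And>q vs. q \<in> U \<Longrightarrow> length vs = k \<Longrightarrow> set vs \<subseteq> tangent_space n A q \<Longrightarrow>
           \<omega> q vs = (\<Sum>I\<in>multi_indices n k. a I q * (\<Prod>r<k. coord_covector (U, x) (I ! r) (vs ! r)))"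
    and "length Xs = k + 1"
    and "set Xs \<subseteq> vector_fields n A U"
    and "p \<in> U"
  shows "local_value n A (leibniz_coboundary n A (tensor_operator \<omega>)) Xs p =
    L_op n (U, x) k a Xs p +
    (\<Sum>I\<in>multi_indices n k. a I p *
      (\<Sum>r=0..k-2. (-1) ^ r *
         op_tensor (map (dx (U, x)) (take r I)) (S_op n (U, x) (drop r I)) Xs p))"
    (is "_ = ?rhs")
proof -
  interpret smooth_atlas n A by (rule smooth_atlas.intro) (rule assms(1))
  have len: "length Xs = Suc k" using assms(7) by simp
  define D where "D = (\<lambda>t i. dx (U, x) i (Xs ! t) p)"
  define E where "E = (\<lambda>l t i. d_dx (U, x) l i (Xs ! t) p)"
  \<comment> \<open>any admissible global fields give the right value, so the value is well defined once they exist\<close>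
  have coboundary: "leibniz_coboundary n A (tensor_operator \<omega>) Ys p = ?rhs"
    if Ys: "length Ys = Suc k" "set Ys \<subseteq> vector_fields n A UNIV"
      and eq: "\<And>t. t < Suc k \<Longrightarrow> \<forall>\<^sub>F q in nhds p. (Ys ! t) q = (Xs ! t) q" for Ys
  proof -
    have "set Ys \<subseteq> vector_fields n A U"
      using Ys(2) vector_field_subset[of _ UNIV U] by auto
    moreover have "dx (U, x) i (Ys ! t) p = D t i" if "t \<le> k" for t i
      using eventually_nhds_x_imp_x[OF eq[of t]] that by (simp add: D_def dx_def)
    moreover have "d_dx (U, x) l i (Ys ! t) p = E l t i" if "t \<le> k" "l < n" for l t i
    proof -
      have "\<forall>\<^sub>F q in nhds p. dx (U, x) i (Ys ! t) q = dx (U, x) i (Xs ! t) q"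
        using eq[OF le_imp_less_Suc[OF that(1)]] by eventually_elim (simp add: dx_def)
      then show ?thesis
        unfolding E_def d_dx_def by (rule coord_deriv_cong[OF assms(4,9) that(2)])
    qed
    ultimately show ?thesis
      using leibniz_coboundary_local_formula[OF assms(4,9,5,6) Ys(1), of D E]
        local_operators_formula[OF assms(2) len, of "(U, x)" p D E a]
      by (simp add: D_def E_def)
  qed
  have "\<exists>Y. Y \<in> vector_fields n A UNIV \<and> (\<forall>\<^sub>F q in nhds p. Y q = (Xs ! t) q)" if "t < Suc k" for t
  proof -
    have "Xs ! t \<in> vector_fields n A U"
      using assms(8) len that nth_mem[of t Xs] by auto
    from vector_field_extension[OF assms(4,9) this] show ?thesis by blast
  qed
  then obtain Y where Y: "\<And>t. t < Suc k \<Longrightarrow> Y t \<in> vector_fields n A UNIV"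
      "\<And>t. t < Suc k \<Longrightarrow> \<forall>\<^sub>F q in nhds p. Y t q = (Xs ! t) q"
    by metis
  define Ys where "Ys = map Y [0..<Suc k]"
  have Ys: "length Ys = Suc k" "set Ys \<subseteq> vector_fields n A UNIV"
      "\<And>t. t < Suc k \<Longrightarrow> \<forall>\<^sub>F q in nhds p. (Ys ! t) q = (Xs ! t) q"
    using Y by (auto simp: Ys_def simp del: upt_Suc)
  show ?thesis
    unfolding local_value_def
  proof (rule the_equality)
    show "\<exists>Ys. length Ys = length Xs \<and> set Ys \<subseteq> vector_fields n A UNIV \<and>
        (\<forall>i<length Xs. \<forall>\<^sub>F q in nhds p. (Ys ! i) q = (Xs ! i) q) \<and>
        ?rhs = leibniz_coboundary n A (tensor_operator \<omega>) Ys p"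
      using Ys coboundary[OF Ys] len by (intro exI[of _ Ys]) simp
  qed (use coboundary len in auto)
qed

end
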